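(* Let $\mathcal X$ be a Stonean vector lattice, i.e. $X\wedge Y,\ X\vee Y\in\mathcal X$ for all $X,Y\in\mathcal X$, and let $\rho:\mathcal X\to\mathbb R$ be a law-invariant coherent risk measure with associated distortion function $g_\rho$ such that $\lim_{k\to\infty}\rho(-(X-k)^+)=0$ for all nonnegative $X\in\mathcal X$ and $\lim_{t\downarrow0}g_\rho(t)=0$. Let $F_0\in\mathbb F_{\mathcal X}$, let $\phi$ be a weight function, and assume: (a) there is a finite set $D(F_0)$ of real numbers such that $F_0$ is continuously differentiable with strictly positive derivative on $(F_0^{\rightarrow}(0),F_0^{\leftarrow}(1))\setminus D(F_0)$; (b) $\int_{F_0^{\rightarrow}(0)}^{F_0^{\leftarrow}(1)}\frac{g_\rho(\gamma F_0(x))}{F_0(x)\phi(x)}\,dx<\infty$ for some $\gamma\in(0,1)$. Let $\mathcal G_\rho$ be the representing set of continuous concave distortion functions described in the context. Then the functional $\mathcal R_\rho:\mathbb F_{\mathcal X}\to\mathbb R$ is quasi-Hadamard differentiable at $F_0$ tangentially to $C_{\phi,F_0}\langle D_{\phi,F_0}\rangle$ with quasi-Hadamard derivative $$\dot{\mathcal R}_{\rho,F_0}(v)=\lim_{\varepsilon\downarrow0}\ \sup_{g\in\mathcal G_\rho(F_0,\varepsilon)}\int_{F_0^{\rightarrow}(0)}^{F_0^{\leftarrow}(1)}g'(F_0(x))\,v(x)\,dx,\qquad v\in C_{\phi,F_0},$$ where $\mathcal G_\rho(F_0,\varepsilon)$ is the set of all $g\in\mathcal G_\rho$ with $\mathcal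 R_\rho(F_0)-\varepsilon\le\mathcal R_g(F_0)$ and $g'$ is the right-sided derivative of $g$. If in addition $\int_{-\infty}^0 g_\rho(\delta F_0(x))\,dx<\infty$ for some $\delta\in(0,1)$, then the set $\mathcal G_\rho(F_0)$ of all $g\in\mathcal G_\rho$ with $\mathcal R_\rho(F_0)=\mathcal R_g(F_0)$ is nonempty, and $$\dot{\mathcal R}_{\rho,F_0}(v)=\sup_{g\in\mathcal G_\rho(F_0)}\int_{F_0^{\rightarrow}(0)}^{F_0^{\leftarrow}(1)}g'(F_0(x))\,v(x)\,dx,\qquad v\in C_{\phi,F_0}.$$
   Context: $(\Omega,\mathcal F,\mathbb P)$ is an atomless probability space and $\mathcal X$ is a linear subspace of $L^1(\Omega,\mathcal F,\mathbb P)$ containing $L^\infty(\Omega,\mathcal F,\mathbb P)$. $F_X$ denotes the distribution function of $X$, and $\mathbb F_{\mathcal X}$ the set of distribution functions of elements of $\mathcal X$. For a distribution function $F$, $F^{\leftarrow}(s):=\inf\{x\in\mathbb R:F(x)\ge s\}$ and $F^{\rightarrow}(s):=\inf\{x\in\mathbb R:F(x)>s\}$ (values $\pm\infty$ possible). A map $\rho:\mathcal X\to\mathbb R$ is a coherent risk measure if it is monotone ($\rho(X)\ge\rho(Y)$ whenever $X\le Y$), cash-invariant ($\rho(X+m)=\rho(X)-m$ for $m\in\mathbb R$), subadditive and positively homogeneous ($\rho(\lambda X)=\lambda\rho(X)$, $\lambda\ge0$). It is law-invariant if $\rho(X)=\rho(Y)$ whenever $X,Y$ have the same law; then $\mathcal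 R_\rho:\mathbb F_{\mathcal X}\to\mathbb R$ is defined by $\mathcal R_\rho(F_X):=\rho(X)$. A distortion function is a nondecreasing $g:[0,1]\to[0,1]$ with $g(0)=0$, $g(1)=1$. For a concave distortion function $g$, $\rho_g(X)=\int_{-\infty}^0 g(F_X(x))\,dx-\int_0^\infty(1-g(F_X(x)))\,dx$ and $\mathcal R_g(F_X):=\rho_g(X)$. The distortion function associated with $\rho$ is $g_\rho(t):=\rho(-B_{1,t})$, with $B_{1,t}$ Bernoulli with expectation $t\in[0,1]$. Under the assumptions on $\mathcal X$ and $\rho$ in the first sentence of the claim there exists a set $\mathcal G_\rho$ of continuous concave distortion functions such that: (i) $\mathcal G_\rho$ is compact for the uniform metric; (ii) $g_\rho=\sup_{g\in\mathcal G_\rho}g$; (iii) $\sup_{g\in\mathcal G_\rho}g'(t)\le g_\rho(\gamma t)/(\gamma t)$ for all $\gamma,t\in(0,1)$; (iv) $\rho(X)=\sup_{g\in\mathcal G_\rho}\rho_g(X)$ for all $X\in\mathcal X$; (v) for every $X\in\mathcal X$ the map $\mathcal G_\rho\to\mathbb R$, $g\mapsto\rho_g(X)$ is lower semicontinuous for the uniform metric, and continuous if $\int_{-\infty}^0g_\rho(\gamma F_X(x))\,dx<\infty$ for some $\gamma\in(0,1)$. Such a set is fixed and denoted $\mathcal G_\rho$. A weight function is a continuous function $\phi:\mathbb R\to[1,\infty)$ that is nonincreasing on $(-\infty,0]$ and nondecreasing on $[0,\infty)$. $D_\phi$ is the space of all càdlàg functions $v$ on $\mathbb R$ with $\|v\|_\phi:=\sup_{x}|v(x)\phi(x)|<\infty$;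 $D_{\phi,F_0}$ is the subspace of all $v\in D_\phi$ vanishing outside $[F_0^{\rightarrow}(0),F_0^{\leftarrow}(1)]$; $C_{\phi,F_0}$ is the set of all $v\in D_{\phi,F_0}$ whose discontinuity points in $(F_0^{\rightarrow}(0),F_0^{\leftarrow}(1))$ are discontinuity points of $F_0$. Both carry the norm $\|\cdot\|_\phi$. Quasi-Hadamard differentiability of $\mathcal R_\rho$ at $F_0$ tangentially to $C_{\phi,F_0}\langle D_{\phi,F_0}\rangle$ with derivative $\dot{\mathcal R}_{\rho,F_0}$ means: $\dot{\mathcal R}_{\rho,F_0}:C_{\phi,F_0}\to\mathbb R$ is continuous and $$\lim_{n\to\infty}\Big|\frac{\mathcal R_\rho(F_0+h_nv_n)-\mathcal R_\rho(F_0)}{h_n}-\dot{\mathcal R}_{\rho,F_0}(v)\Big|=0$$ for every triplet $(v,(v_n),(h_n))$ with $v\in C_{\phi,F_0}$, $(v_n)\subset D_{\phi,F_0}$, $\|v_n-v\|_\phi\to0$, $(F_0+h_nv_n)\subset\mathbb F_{\mathcal X}$, $(h_n)\subset(0,\infty)$, $h_n\to0$. *)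

theory Defs
  imports "HOL-Probability.Probability"
begin

section \<open>Random variables and law-invariant coherent risk measures\<close>

definition atomless :: "'a measure \<Rightarrow> bool" where
  "atomless M \<longleftrightarrow>
     (\<forall>A\<in>sets M. 0 < measure M A \<longrightarrow>
        (\<exists>B\<in>sets M. B \<subseteq> A \<and> 0 < measure M B \<and> measure M B < measure M A))"

text \<open>
  A linear subspace of \<open>L\<^sup>1\<close> containing \<open>L\<^sup>\<infinity>\<close> is represented by the set of all measurable functions
  whose almost-sure equivalence class belongs to it. Closure of \<open>XX\<close> under almost-sure equality is not
  listed because it follows: if \<open>X\<close> is in \<open>XX\<close> and \<open>Y\<close> is measurable with \<open>Y = X\<close> almost surely,
  then \<open>Y - X\<close> is essentially bounded.
\<close>
definition risk_space :: "'a measure \<Rightarrow> ('a \<Rightarrow> real) set \<Rightarrow> bool" where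
  "risk_space M XX \<longleftrightarrow>
     (\<forall>X\<in>XX. integrable M X) \<and>
     (\<forall>X\<in>borel_measurable M. (\<exists>c. AE \<omega> in M. \<bar>X \<omega>\<bar> \<le> c) \<longrightarrow> X \<in> XX) \<and>
     (\<forall>X\<in>XX. \<forall>Y\<in>XX. (\<lambda>\<omega>. X \<omega> + Y \<omega>) \<in> XX) \<and>
     (\<forall>X\<in>XX. \<forall>c::real. (\<lambda>\<omega>. c * X \<omega>) \<in> XX)"

definition stonean :: "('a \<Rightarrow> real) set \<Rightarrow> bool" where
  "stonean XX \<longleftrightarrow>
     (\<forall>X\<in>XX. \<forall>Y\<in>XX. (\<lambda>\<omega>. min (X \<omega>) (Y \<omega>)) \<in> XX \<and> (\<lambda>\<omega>. max (X \<omega>) (Y \<omega>)) \<in> XX)"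

definition coherent_risk_measure ::
    "'a measure \<Rightarrow> ('a \<Rightarrow> real) set \<Rightarrow> (('a \<Rightarrow> real) \<Rightarrow> real) \<Rightarrow> bool" where
  "coherent_risk_measure M XX \<rho> \<longleftrightarrow>
     (\<forall>X\<in>XX. \<forall>Y\<in>XX. (AE \<omega> in M. X \<omega> \<le> Y \<omega>) \<longrightarrow> \<rho> X \<ge> \<rho> Y) \<and>
     (\<forall>X\<in>XX. \<forall>m::real. \<rho> (\<lambda>\<omega>. X \<omega> + m) = \<rho> X - m) \<and>
     (\<forall>X\<in>XX. \<forall>Y\<in>XX. \<rho> (\<lambda>\<omega>. X \<omega> + Y \<omega>) \<le> \<rho> X + \<rho> Y) \<and>
     (\<forall>X\<in>XX. \<forall>c\<ge>0. \<rho> (\<lambda>\<omega>. c * X \<omega>) = c * \<rho> X)"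

definition law_invariant ::
    "'a measure \<Rightarrow> ('a \<Rightarrow> real) set \<Rightarrow> (('a \<Rightarrow> real) \<Rightarrow> real) \<Rightarrow> bool" where
  "law_invariant M XX \<rho> \<longleftrightarrow>
     (\<forall>X\<in>XX. \<forall>Y\<in>XX. distr M borel X = distr M borel Y \<longrightarrow> \<rho> X = \<rho> Y)"

definition df :: "'a measure \<Rightarrow> ('a \<Rightarrow> real) \<Rightarrow> real \<Rightarrow> real" where
  "df M X = cdf (distr M borel X)"

definition dfs :: "'a measure \<Rightarrow> ('a \<Rightarrow> real) set \<Rightarrow> (real \<Rightarrow> real) set" where
  "dfs M XX = df M ` XX"

definition risk_functional ::
    "'a measure \<Rightarrow> ('a \<Rightarrow> real) set \<Rightarrow> (('a \<Rightarrow> real) \<Rightarrow> real) \<Rightarrow> (real \<Rightarrow> real) \<Rightarrow> real" where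
  "risk_functional M XX \<rho> F = (THE r. \<exists>X\<in>XX. df M X = F \<and> r = \<rho> X)"

definition bernoulli_rv :: "'a measure \<Rightarrow> real \<Rightarrow> ('a \<Rightarrow> real) \<Rightarrow> bool" where
  "bernoulli_rv M t B \<longleftrightarrow> B \<in> borel_measurable M \<and>
     distr M borel B = distr (measure_pmf (bernoulli_pmf t)) borel of_bool"

text \<open>Only the values for \<open>t\<close> in \<open>[0,1]\<close> are meaningful.\<close>
definition assoc_distortion :: "'a measure \<Rightarrow> (('a \<Rightarrow> real) \<Rightarrow> real) \<Rightarrow> real \<Rightarrow> real" where
  "assoc_distortion M \<rho> t = (THE r. \<exists>B. bernoulli_rv M t B \<and> r = \<rho> (\<lambda>\<omega>. - B \<omega>))"

section \<open>Distribution functions and distortions\<close>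

definition left_quantile :: "(real \<Rightarrow> real) \<Rightarrow> real \<Rightarrow> ereal" where
  "left_quantile F s = Inf {ereal x | x. F x \<ge> s}"

definition right_quantile :: "(real \<Rightarrow> real) \<Rightarrow> real \<Rightarrow> ereal" where
  "right_quantile F s = Inf {ereal x | x. F x > s}"

definition distortion_function :: "(real \<Rightarrow> real) \<Rightarrow> bool" where
  "distortion_function g \<longleftrightarrow>
     g \<in> {0..1} \<rightarrow> {0..1} \<and> mono_on {0..1} g \<and> g 0 = 0 \<and> g 1 = 1"

text \<open>
  The functional \<open>R\<^sub>g\<close>. It is extended-real-valued because the first integral may be infinite;
  for concave \<open>g\<close> and \<open>F\<close> the distribution function of an integrable random variable the second
  integral is finite, since \<open>g t \<ge> t\<close> on \<open>[0,1]\<close>.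
\<close>
definition distortion_risk :: "(real \<Rightarrow> real) \<Rightarrow> (real \<Rightarrow> real) \<Rightarrow> ereal" where
  "distortion_risk g F =
     enn2ereal (\<integral>\<^sup>+x\<in>{..0}. ennreal (g (F x)) \<partial>lborel)
     - enn2ereal (\<integral>\<^sup>+x\<in>{0..}. ennreal (1 - g (F x)) \<partial>lborel)"

definition right_deriv :: "(real \<Rightarrow> real) \<Rightarrow> real \<Rightarrow> real" where
  "right_deriv g t = (THE d. (g has_real_derivative d) (at_right t))"

text \<open>
  The continuous functions on \<open>[0,1]\<close> (extended by \<open>undefined\<close> outside) with the uniform metric.
\<close>
abbreviation uniform_topology :: "(real \<Rightarrow> real) topology" where
  "uniform_topology \<equiv> mtopology_of (cfunspace (top_of_set {0..1::real}) euclidean_metric)"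

definition lower_semicontinuous_map :: "'b topology \<Rightarrow> ('b \<Rightarrow> ereal) \<Rightarrow> bool" where
  "lower_semicontinuous_map T f \<longleftrightarrow> (\<forall>c. openin T {x \<in> topspace T. c < f x})"

definition representing_set ::
    "'a measure \<Rightarrow> ('a \<Rightarrow> real) set \<Rightarrow> (('a \<Rightarrow> real) \<Rightarrow> real) \<Rightarrow> (real \<Rightarrow> real) set \<Rightarrow> bool" where
  "representing_set M XX \<rho> G \<longleftrightarrow>
     (\<forall>g\<in>G. distortion_function g \<and> continuous_on {0..1} g \<and> concave_on {0..1} g) \<and>
     compactin uniform_topology G \<and>
     (\<forall>t\<in>{0..1}. assoc_distortion M \<rho> t = (SUP g\<in>G. g t)) \<and>
     (\<forall>\<gamma>\<in>{0<..<1}. \<forall>t\<in>{0<..<1}.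
        (SUP g\<in>G. ereal (right_deriv g t)) \<le> ereal (assoc_distortion M \<rho> (\<gamma> * t) / (\<gamma> * t))) \<and>
     (\<forall>X\<in>XX. ereal (\<rho> X) = (SUP g\<in>G. distortion_risk g (df M X))) \<and>
     (\<forall>X\<in>XX.
        lower_semicontinuous_map (subtopology uniform_topology G)
          (\<lambda>g. distortion_risk g (df M X)) \<and>
        ((\<exists>\<gamma>\<in>{0<..<1}.
            (\<integral>\<^sup>+x\<in>{..0}. ennreal (assoc_distortion M \<rho> (\<gamma> * df M X x)) \<partial>lborel) < \<infinity>) \<longrightarrow>
         continuous_map (subtopology uniform_topology G) euclidean
           (\<lambda>g. distortion_risk g (df M X))))"

section \<open>Weighted spaces and quasi-Hadamard differentiability\<close>

definition weight_function :: "(real \<Rightarrow> real) \<Rightarrow> bool" where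
  "weight_function \<phi> \<longleftrightarrow> continuous_on UNIV \<phi> \<and> (\<forall>x. 1 \<le> \<phi> x) \<and>
     antimono_on {..0} \<phi> \<and> mono_on {0..} \<phi>"

definition cadlag :: "(real \<Rightarrow> real) \<Rightarrow> bool" where
  "cadlag v \<longleftrightarrow> (\<forall>x. continuous (at_right x) v \<and> (\<exists>l. (v \<longlongrightarrow> l) (at_left x)))"

definition weighted_norm :: "(real \<Rightarrow> real) \<Rightarrow> (real \<Rightarrow> real) \<Rightarrow> real" where
  "weighted_norm \<phi> v = (SUP x. \<bar>v x * \<phi> x\<bar>)"

definition D_weighted :: "(real \<Rightarrow> real) \<Rightarrow> (real \<Rightarrow> real) set" where
  "D_weighted \<phi> = {v. cadlag v \<and> bdd_above (range (\<lambda>x. \<bar>v x * \<phi> x\<bar>))}"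

definition D_supported :: "(real \<Rightarrow> real) \<Rightarrow> (real \<Rightarrow> real) \<Rightarrow> (real \<Rightarrow> real) set" where
  "D_supported \<phi> F0 = {v \<in> D_weighted \<phi>.
     \<forall>x. \<not> (right_quantile F0 0 \<le> ereal x \<and> ereal x \<le> left_quantile F0 1) \<longrightarrow> v x = 0}"

definition C_tangent :: "(real \<Rightarrow> real) \<Rightarrow> (real \<Rightarrow> real) \<Rightarrow> (real \<Rightarrow> real) set" where
  "C_tangent \<phi> F0 = {v \<in> D_supported \<phi> F0.
     \<forall>x\<in>einterval (right_quantile F0 0) (left_quantile F0 1). \<not> isCont v x \<longrightarrow> \<not> isCont F0 x}"

definition has_quasi_Hadamard_derivative ::
    "((real \<Rightarrow> real) \<Rightarrow> real) \<Rightarrow> (real \<Rightarrow> real) set \<Rightarrow> (real \<Rightarrow> real) \<Rightarrow>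
     (real \<Rightarrow> real) \<Rightarrow> ((real \<Rightarrow> real) \<Rightarrow> real) \<Rightarrow> bool" where
  "has_quasi_Hadamard_derivative R FF F0 \<phi> R' \<longleftrightarrow>
     (\<forall>v\<in>C_tangent \<phi> F0. \<forall>e>0. \<exists>d>0. \<forall>w\<in>C_tangent \<phi> F0.
        weighted_norm \<phi> (\<lambda>x. w x - v x) < d \<longrightarrow> \<bar>R' w - R' v\<bar> < e) \<and>
     (\<forall>v vs (hs :: nat \<Rightarrow> real).
        v \<in> C_tangent \<phi> F0 \<and> (\<forall>n. vs n \<in> D_supported \<phi> F0) \<and>
        (\<lambda>n. weighted_norm \<phi> (\<lambda>x. vs n x - v x)) \<longlonglongrightarrow> 0 \<and>
        (\<forall>n. (\<lambda>x. F0 x + hs n * vs n x) \<in> FF) \<and>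
        (\<forall>n. 0 < hs n) \<and> hs \<longlonglongrightarrow> 0 \<longrightarrow>
        (\<lambda>n. \<bar>(R (\<lambda>x. F0 x + hs n * vs n x) - R F0) / hs n - R' v\<bar>) \<longlonglongrightarrow> 0)"

section \<open>The candidate derivative\<close>

definition approx_maximizers ::
    "(real \<Rightarrow> real) set \<Rightarrow> ((real \<Rightarrow> real) \<Rightarrow> real) \<Rightarrow> (real \<Rightarrow> real) \<Rightarrow> real \<Rightarrow> (real \<Rightarrow> real) set" where
  "approx_maximizers G R F0 \<epsilon> = {g \<in> G. ereal (R F0 - \<epsilon>) \<le> distortion_risk g F0}"

definition maximizers ::
    "(real \<Rightarrow> real) set \<Rightarrow> ((real \<Rightarrow> real) \<Rightarrow> real) \<Rightarrow> (real \<Rightarrow> real) \<Rightarrow> (real \<Rightarrow> real) set" where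
  "maximizers G R F0 = {g \<in> G. ereal (R F0) = distortion_risk g F0}"

definition distortion_derivative ::
    "(real \<Rightarrow> real) \<Rightarrow> (real \<Rightarrow> real) \<Rightarrow> (real \<Rightarrow> real) \<Rightarrow> real" where
  "distortion_derivative g F0 v =
     (LBINT x=right_quantile F0 0..left_quantile F0 1. right_deriv g (F0 x) * v x)"

end

theory Submission
  imports Defs
begin

text \<open>
  Write \<open>R\<^sub>g(F) = \<integral> (g(F) - 1\<^bsub>[0,\<infinity>)\<^esub>)\<close>, so that \<open>R\<^sub>g(F\<^sub>0 + h v) - R\<^sub>g(F\<^sub>0)\<close> is the integral of
  \<open>g(F\<^sub>0 + h v) - g(F\<^sub>0)\<close>. Concavity and \<open>g(0) = 0\<close> give the bound
  \<open>\<bar>g(s) - g(t)\<bar> \<le> \<bar>s - t\<bar> g(t) / t\<close>, which together with (b) yields one integrable majorant for all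
  difference quotients with \<open>g\<close> in \<open>G\<close>. If \<open>g\<^sub>n \<rightarrow> g\<close> in \<open>G\<close>, the chord slopes and right derivatives
  of \<open>g\<^sub>n\<close> converge at every continuity point of \<open>g'\<close>; as \<open>g'\<close> is monotone and, by (a), \<open>F\<^sub>0\<close> is
  injective between its quantiles, this happens at \<open>F\<^sub>0(x)\<close> for almost every \<open>x\<close>. Dominated convergence
  and compactness of \<open>G\<close> then make the first-order expansion of \<open>R\<^sub>g\<close> uniform in \<open>g\<close>, and Danskin's
  argument differentiates the supremum.
\<close>

section \<open>Concave distortion functions\<close>

text \<open>The supremum over \<open>G\<close> need not be attained, and its near maximizers move
  with \<open>h n\<close>. An expansion for each fixed \<open>g\<close> therefore does not suffice:
  the error must be small against \<open>h n\<close> for all \<open>g \<in> G\<close> at once, and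
  limits are taken along sequences in which \<open>g\<close> and the increment vary together. Kinks
  are the obstacle, since at a kink of the limit \<open>g\<close> neither chord slopes nor right
  derivatives need converge. There are countably many kinks, but a flat piece of \<open>F0\<close>
  at a kink level would give them positive Lebesgue measure; this is why injectivity of
  \<open>F0\<close> is extracted from (a). Increments are bounded by the secant slope from the
  origin and not by a derivative near the perturbed point, because \<open>F0 x + h * v x\<close> may
  come down to \<open>0\<close>, where \<open>g\<close> can be infinitely steep. The
  \<open>\<gamma>\<close> in (b) is matched to this secant slope by the monotonicity of
  \<open>g t / t\<close>.\<close>

lemma concave_on_slopes:
  fixes g :: "real \<Rightarrow> real"
  assumes "concave_on I g" "x \<in> I" "z \<in> I" "x < y" "y < z"
  shows "(g z - g x) / (z - x) \<le> (g y - g x) / (y - x)"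
    and "(g z - g y) / (z - y) \<le> (g z - g x) / (z - x)"
  using convex_on_slope_le[of I "\<lambda>x. - g x" x z y] assms
  by (simp_all add: concave_on_def field_simps)

lemma concave_on_slopes':
  fixes g :: "real \<Rightarrow> real"
  assumes "concave_on I g" "x \<in> I" "z \<in> I" "x < y" "y < z"
  shows "(g z - g y) / (z - y) \<le> (g y - g x) / (y - x)"
  using concave_on_slopes[OF assms] by linarith

text \<open>Chord slopes from \<open>t\<close> increase as the right end decreases to
  \<open>t\<close>, and the chord back to \<open>0\<close> bounds them from above, so they converge
  to their supremum. As \<open>right_deriv\<close> is a definite description, uniqueness of the
  limit is recorded as well.\<close>

lemma has_right_deriv:
  assumes g: "concave_on {0..1} g" and t: "0 < t" "t < 1"
  shows "(g has_real_derivative right_deriv g t) (at_right t)"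
proof -
  define q where "q s = (g s - g t) / (s - t)" for s
  have anti: "q s' \<le> q s" if "t < s" "s \<le> s'" "s' \<le> 1" for s s'
    using concave_on_slopes(1)[OF g, of t s' s] that t unfolding q_def
    by (cases "s = s'") auto
  have bd: "q s \<le> (g t - g 0) / (t - 0)" if "t < s" "s \<le> 1" for s
    using concave_on_slopes'[OF g, of 0 s t] that t unfolding q_def by auto
  have bdd: "bdd_above (q ` {t<..1})"
    using bd by (intro bdd_aboveI2[where M = "(g t - g 0) / (t - 0)"]) auto
  define l where "l = (SUP s\<in>{t<..1}. q s)"
  have "(q \<longlongrightarrow> l) (at_right t)"
  proof (rule increasing_tendsto)
    have "q s \<le> l" if "t < s" "s < 1" for s
      unfolding l_def by (rule cSUP_upper) (use bdd that in auto)
    then show "eventually (\<lambda>s. q s \<le> l) (at_right t)"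
      using t by (auto simp: eventually_at_right)
  next
    fix x assume "x < l"
    then obtain s where s: "s \<in> {t<..1}" "x < q s"
      unfolding l_def by (subst (asm) less_cSUP_iff) (use t bdd in auto)
    have "x < q u" if "t < u" "u < s" for u
      using anti[of u s] that s by auto
    then show "eventually (\<lambda>u. x < q u) (at_right t)"
      using s by (intro eventually_at_rightI[of _ s]) auto
  qed
  then have d: "(g has_real_derivative l) (at_right t)"
    by (simp add: has_field_derivative_iff q_def[abs_def])
  have "right_deriv g t = l"
    unfolding right_deriv_def
  proof (rule the_equality)
    show "(g has_real_derivative l) (at_right t)" by (fact d)
  next
    fix d' assume d': "(g has_real_derivative d') (at_right t)"
    show "d' = l"
      by (rule tendsto_unique[OF trivial_limit_at_right_real
            d'[unfolded has_field_derivative_iff] d[unfolded has_field_derivative_iff]])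
  qed
  with d show ?thesis by simp
qed

lemma right_deriv_ge_slope:
  assumes g: "concave_on {0..1} g" and "0 < t" "t < s" "s \<le> 1"
  shows "(g s - g t) / (s - t) \<le> right_deriv g t"
proof (rule tendsto_lowerbound)
  show "((\<lambda>y. (g y - g t) / (y - t)) \<longlongrightarrow> right_deriv g t) (at_right t)"
    using has_right_deriv[OF g, of t] assms by (simp add: has_field_derivative_iff)
  have "(g s - g t) / (s - t) \<le> (g y - g t) / (y - t)" if "t < y" "y < s" for y
    using concave_on_slopes(1)[OF g, of t s y] that assms by auto
  then show "\<forall>\<^sub>F y in at_right t. (g s - g t) / (s - t) \<le> (g y - g t) / (y - t)"
    using assms by (auto simp: eventually_at_right)
qed simp

lemma right_deriv_le_slope:
  assumes g: "concave_on {0..1} g" and "0 \<le> s" "s < t" "t < 1"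
  shows "right_deriv g t \<le> (g t - g s) / (t - s)"
proof (rule tendsto_upperbound)
  show "((\<lambda>y. (g y - g t) / (y - t)) \<longlongrightarrow> right_deriv g t) (at_right t)"
    using has_right_deriv[OF g, of t] assms by (simp add: has_field_derivative_iff)
  have "(g y - g t) / (y - t) \<le> (g t - g s) / (t - s)" if "t < y" "y < 1" for y
    using concave_on_slopes'[OF g, of s y t] that assms by auto
  then show "\<forall>\<^sub>F y in at_right t. (g y - g t) / (y - t) \<le> (g t - g s) / (t - s)"
    using assms by (auto simp: eventually_at_right)
qed simp

lemma right_deriv_antimono:
  assumes g: "concave_on {0..1} g" and "0 < s" "s \<le> t" "t < 1"
  shows "right_deriv g t \<le> right_deriv g s"
  using right_deriv_le_slope[OF g, of s t] right_deriv_ge_slope[OF g, of s t] assms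
  by (cases "s = t") auto

lemma countable_right_deriv_discont:
  assumes g: "concave_on {0..1} g"
  shows "countable {t\<in>{0<..<1}. \<not> isCont (right_deriv g) t}"
proof -
  have "mono_on {0<..<1} (\<lambda>t. - right_deriv g t)"
    using right_deriv_antimono[OF g] by (auto intro!: mono_onI)
  then have "countable {t\<in>{0<..<1}. \<not> continuous (at t within {0<..<1}) (\<lambda>t. - right_deriv g t)}"
    by (rule mono_on_ctble_discont)
  \<comment> \<open>The interval is open, so continuity relative to it is continuity at the
    point.\<close>
  moreover have "{t\<in>{0<..<1}. \<not> isCont (right_deriv g) t}
      \<subseteq> {t\<in>{0<..<1}. \<not> continuous (at t within {0<..<1}) (\<lambda>t. - right_deriv g t)}"
  proof (rule Collect_mono, rule impI, elim conjE, rule conjI, assumption, rule notI)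
    fix t :: real
    assume t: "t \<in> {0<..<1}" "continuous (at t within {0<..<1}) (\<lambda>t. - right_deriv g t)"
    then have "isCont (\<lambda>t. - right_deriv g t) t" by (simp only: at_within_open[OF t(1) open_greaterThanLessThan])
    from isCont_minus[OF this] have "isCont (right_deriv g) t" by simp
    moreover assume "\<not> isCont (right_deriv g) t"
    ultimately show False by contradiction
  qed
  ultimately show ?thesis by (rule countable_subset[rotated])
qed

text \<open>Continuity of \<open>right_deriv g\<close> at \<open>t\<close> puts the slope of
  \<open>g\<close> over \<open>[t, t + d]\<close> above \<open>right_deriv g t - e / 2\<close> and
  that over \<open>[t - d, t]\<close> below \<open>right_deriv g t + e / 2\<close>. Convergence at
  three points carries this over to \<open>gs n\<close> with \<open>e\<close>, and concavity traps
  the right derivative and all shorter chords at \<open>t\<close> between the two slopes. So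
  pointwise convergence yields an estimate uniform in \<open>s\<close>.\<close>

lemma concave_seq_slopes_near:
  fixes gs :: "nat \<Rightarrow> real \<Rightarrow> real"
  assumes gs: "\<And>n. concave_on {0..1} (gs n)" and g: "concave_on {0..1} g"
    and lim: "\<And>t. t \<in> {0..1} \<Longrightarrow> (\<lambda>n. gs n t) \<longlonglongrightarrow> g t"
    and t: "0 < t" "t < 1" and cont: "isCont (right_deriv g) t" and e: "0 < e"
  obtains d where "0 < d"
    "\<forall>\<^sub>F n in sequentially. \<bar>right_deriv (gs n) t - right_deriv g t\<bar> \<le> e \<and>
       (\<forall>s\<in>{0..1}. \<bar>s - t\<bar> < d \<longrightarrow>
          \<bar>gs n s - gs n t - right_deriv g t * (s - t)\<bar> \<le> e * \<bar>s - t\<bar>)"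
proof -
  let ?r = "right_deriv g"
  from cont e obtain d0 where d0: "0 < d0" "\<And>s. \<bar>s - t\<bar> < d0 \<Longrightarrow> \<bar>?r s - ?r t\<bar> < e / 2"
    unfolding isCont_def LIM_def dist_real_def
    by (metis abs_zero e half_gt_zero right_minus_eq)
  \<comment> \<open>The first bound keeps \<open>t - d\<close> and \<open>t + d\<close> within the
    continuity radius, the other two keep them in the open unit interval.\<close>
  define d where "d = min (d0 / 2) (min (t / 2) ((1 - t) / 2))"
  have d: "0 < d" "d < d0" "0 < t - d" "t + d < 1"
    using d0(1) t by (auto simp: d_def min_def field_simps)
  have r1: "?r t - e / 2 < ?r (t + d)" "?r (t - d) < ?r t + e / 2"
    using d0(2)[of "t + d"] d0(2)[of "t - d"] d(1,2) by linarith+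
  have r2: "?r t - e / 2 < (g (t + d) - g t) / d"
    using right_deriv_le_slope[OF g, of t "t + d"] r1 d t by simp
  have r3: "(g t - g (t - d)) / d < ?r t + e / 2"
    using right_deriv_ge_slope[OF g, of "t - d" t] r1 d t by simp
  have l1: "(\<lambda>n. (gs n (t + d) - gs n t) / d) \<longlonglongrightarrow> (g (t + d) - g t) / d"
    by (intro tendsto_intros lim) (use d t in auto)
  have l2: "(\<lambda>n. (gs n t - gs n (t - d)) / d) \<longlonglongrightarrow> (g t - g (t - d)) / d"
    by (intro tendsto_intros lim) (use d t in auto)
  have "\<forall>\<^sub>F n in sequentially. \<bar>right_deriv (gs n) t - ?r t\<bar> \<le> e \<and>
       (\<forall>s\<in>{0..1}. \<bar>s - t\<bar> < d \<longrightarrow> \<bar>gs n s - gs n t - ?r t * (s - t)\<bar> \<le> e * \<bar>s - t\<bar>)"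
    using order_tendstoD(1)[OF l1 r2] order_tendstoD(2)[OF l2 r3]
  proof eventually_elim
    case (elim n)
    let ?f = "gs n"
    have b: "(?f (t + d) - ?f t) / d > ?r t - e" "(?f t - ?f (t - d)) / d < ?r t + e"
      using elim e by auto
    have "right_deriv ?f t \<le> (?f t - ?f (t - d)) / d"
      using right_deriv_le_slope[OF gs, of "t - d" t] d t by simp
    moreover have "(?f (t + d) - ?f t) / d \<le> right_deriv ?f t"
      using right_deriv_ge_slope[OF gs, of t "t + d"] d t by simp
    moreover have "\<bar>?f s - ?f t - ?r t * (s - t)\<bar> \<le> e * \<bar>s - t\<bar>"
      if s: "s \<in> {0..1}" "\<bar>s - t\<bar> < d" for s
    proof -
      consider "s = t" | "t < s" | "s < t" by linarith
      then show ?thesis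
      proof cases
        case 2
        have "(?f (t + d) - ?f t) / d \<le> (?f s - ?f t) / (s - t)"
          using concave_on_slopes(1)[OF gs, of t "t + d" s] 2 s d t by simp
        moreover have "(?f s - ?f t) / (s - t) \<le> (?f t - ?f (t - d)) / d"
          using concave_on_slopes'[OF gs, of "t - d" s t] 2 s d t by simp
        ultimately have "\<bar>(?f s - ?f t) / (s - t) - ?r t\<bar> \<le> e"
          using b by linarith
        then have "\<bar>(?f s - ?f t) / (s - t) - ?r t\<bar> * \<bar>s - t\<bar> \<le> e * \<bar>s - t\<bar>"
          by (rule mult_right_mono) simp
        moreover have "((?f s - ?f t) / (s - t) - ?r t) * (s - t) = ?f s - ?f t - ?r t * (s - t)"
          using 2 by (simp add: left_diff_distrib[of _ "?r t"])
        ultimately show ?thesis by (simp only: abs_mult[symmetric])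
      next
        case 3
        have "(?f (t + d) - ?f t) / d \<le> (?f t - ?f s) / (t - s)"
          using concave_on_slopes'[OF gs, of s "t + d" t] 3 s d t by simp
        moreover have "(?f t - ?f s) / (t - s) \<le> (?f t - ?f (t - d)) / d"
          using concave_on_slopes(2)[OF gs, of "t - d" t s] 3 s d t by simp
        ultimately have "\<bar>(?f t - ?f s) / (t - s) - ?r t\<bar> \<le> e"
          using b by linarith
        then have "\<bar>(?f t - ?f s) / (t - s) - ?r t\<bar> * \<bar>t - s\<bar> \<le> e * \<bar>t - s\<bar>"
          by (rule mult_right_mono) simp
        moreover have "((?f t - ?f s) / (t - s) - ?r t) * (t - s) = ?f t - ?f s - ?r t * (t - s)"
          using 3 by (simp add: left_diff_distrib[of _ "?r t"])
        then have "((?f t - ?f s) / (t - s) - ?r t) * (t - s) = - (?f s - ?f t - ?r t * (s - t))"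
          by (simp add: algebra_simps)
        ultimately show ?thesis
          by (simp only: abs_mult[symmetric] abs_minus_cancel abs_minus_commute[of s t])
      qed simp
    qed
    \<comment> \<open>Stated for arbitrary \<open>x\<close> and \<open>y\<close>, to be instantiated
      with the two chord slopes.\<close>
    moreover have "\<bar>right_deriv ?f t - ?r t\<bar> \<le> e" if "x \<le> right_deriv ?f t" "right_deriv ?f t \<le> y"
      "?r t - e < x" "y < ?r t + e" for x y using that by linarith
    ultimately show ?case using b by blast
  qed
  with d(1) show thesis by (rule that)
qed

text \<open>Chords starting or ending at \<open>t\<close> are no steeper than the chord over
  \<open>[0, t]\<close>, whose slope is \<open>g t / t\<close> because \<open>g 0 = 0\<close>;
  monotonicity of \<open>g\<close> then settles the absolute value. The value \<open>s = 0\<close>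
  is allowed.\<close>

lemma concave_distortion_lipschitz_at:
  assumes g: "concave_on {0..1} g" "distortion_function g" and "0 < t" "t \<le> 1" "s \<in> {0..1}"
  shows "\<bar>g s - g t\<bar> \<le> \<bar>s - t\<bar> * (g t / t)"
proof -
  have g0: "g 0 = 0" and mono: "\<And>x y. 0 \<le> x \<Longrightarrow> x \<le> y \<Longrightarrow> y \<le> 1 \<Longrightarrow> g x \<le> g y"
    using g(2) by (auto simp: distortion_function_def mono_on_def)
  consider "s = t" | "t < s" | "s < t" by linarith
  then show ?thesis
  proof cases
    case 2
    have "(g s - g t) / (s - t) \<le> g t / t"
      using concave_on_slopes'[OF g(1), of 0 s t] 2 assms g0 by simp
    then have "g s - g t \<le> g t / t * (s - t)"
      using 2 by (subst (asm) pos_divide_le_eq) auto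
    then show ?thesis using mono[of t s] 2 assms by (simp add: mult.commute)
  next
    case 3
    have "(g t - g s) / (t - s) \<le> g t / t"
    proof (cases "s = 0")
      case True
      then show ?thesis by (simp add: g0)
    next
      case False
      then show ?thesis using concave_on_slopes(2)[OF g(1), of 0 t s] 3 assms g0 by simp
    qed
    then have "g t - g s \<le> g t / t * (t - s)"
      using 3 by (subst (asm) pos_divide_le_eq) auto
    then show ?thesis using mono[of s t] 3 assms by (simp add: mult.commute)
  qed simp
qed

lemma right_deriv_distortion_bounds:
  assumes g: "concave_on {0..1} g" "distortion_function g" and t: "0 < t" "t < 1"
  shows "0 \<le> right_deriv g t" "right_deriv g t \<le> g t / t"
proof -
  have "g t \<le> g 1" "g 0 = 0"
    using g(2) t by (auto simp: distortion_function_def mono_on_def)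
  then show "0 \<le> right_deriv g t" "right_deriv g t \<le> g t / t"
    using right_deriv_ge_slope[OF g(1), of t 1] right_deriv_le_slope[OF g(1), of 0 t] t
    by (auto intro: order_trans[rotated])
qed

text \<open>The secant slope \<open>g t / t\<close> is nonincreasing. This trades the argument
  \<open>t\<close> for \<open>c * t\<close>, at which (b) controls \<open>g\<close>.\<close>

lemma concave_distortion_scale:
  assumes g: "concave_on {0..1} g" "distortion_function g" and t: "0 < t" "t \<le> 1" and c: "0 < c" "c < 1"
  shows "g t \<le> g (c * t) / c"
proof -
  have ct: "0 < c * t" "c * t < t" using t c by auto
  have "g t / t \<le> g (c * t) / (c * t)"
    using concave_on_slopes(1)[OF g(1), of 0 t "c * t"] ct t g(2)
    by (simp add: distortion_function_def)
  then show ?thesis using t c by (simp add: field_simps)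
qed

text \<open>The graph lies above the chord from \<open>(0, 0)\<close> to \<open>(1, 1)\<close>. This
  bounds the right tail \<open>1 - g (F x)\<close> by \<open>1 - F x\<close>.\<close>

lemma concave_distortion_ge:
  assumes g: "concave_on {0..1} g" "distortion_function g" and t: "0 \<le> t" "t \<le> 1"
  shows "t \<le> g t"
  using concave_on_slopes(1)[OF g(1), of 0 1 t] t g(2)
  by (cases "t = 0 \<or> t = 1") (auto simp: distortion_function_def field_simps)

section \<open>Derivative of a supremum\<close>

text \<open>Danskin's argument: the slope of a supremum only sees almost maximizers.\<close>
lemma Danskin_sequence:
  fixes G :: "'g set" and p0 I :: "'g \<Rightarrow> real" and p :: "nat \<Rightarrow> 'g \<Rightarrow> real" and h :: "nat \<Rightarrow> real"
  defines "S0 \<equiv> (SUP g\<in>G. p0 g)" and "J \<equiv> \<lambda>\<epsilon>. SUP g\<in>{g\<in>G. (SUP g\<in>G. p0 g) - \<epsilon> \<le> p0 g}. I g"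
  assumes ne: "G \<noteq> {}" and bdd0: "bdd_above (p0 ` G)" and bdd: "\<And>n. bdd_above (p n ` G)"
    and K: "\<And>g. g \<in> G \<Longrightarrow> \<bar>I g\<bar> \<le> K" and h: "\<And>n. 0 < h n" "h \<longlonglongrightarrow> 0"
    and unif: "\<And>e. 0 < e \<Longrightarrow> \<forall>\<^sub>F n in sequentially. \<forall>g\<in>G. \<bar>p n g - p0 g - h n * I g\<bar> \<le> e * h n"
    and J: "(J \<longlongrightarrow> L) (at_right 0)"
  shows "(\<lambda>n. ((SUP g\<in>G. p n g) - S0) / h n) \<longlonglongrightarrow> L"
proof -
  have K0: "0 \<le> K" using ne K by force
  have bJ: "bdd_above (I ` {g\<in>G. S0 - \<epsilon> \<le> p0 g})" for \<epsilon>
    using K by (auto simp: bdd_above_def abs_le_iff intro!: exI[of _ K])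
  have neJ: "{g\<in>G. S0 - \<epsilon> \<le> p0 g} \<noteq> {}" if "0 < \<epsilon>" for \<epsilon>
  proof -
    have "S0 - \<epsilon> < (SUP g\<in>G. p0 g)" using that by (simp add: S0_def)
    then obtain g where "g \<in> G" "S0 - \<epsilon> < p0 g"
      using less_cSUP_iff[OF ne bdd0] by blast
    then show ?thesis by (auto intro: less_imp_le)
  qed
  have J_eq: "J \<epsilon> = (SUP g\<in>{g\<in>G. S0 - \<epsilon> \<le> p0 g}. I g)" for \<epsilon>
    by (simp add: J_def S0_def)
  have I_le_J: "I g \<le> J \<epsilon>" if "g \<in> G" "S0 - \<epsilon> \<le> p0 g" for g \<epsilon>
    unfolding J_eq by (rule cSUP_upper[OF _ bJ]) (use that in auto)
  have p0_le: "p0 g \<le> S0" if "g \<in> G" for g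
    unfolding S0_def by (rule cSUP_upper[OF that bdd0])
  have p_le: "p n g \<le> (SUP g\<in>G. p n g)" if "g \<in> G" for n g
    by (rule cSUP_upper[OF that bdd])
  show ?thesis
  proof (rule tendstoI)
    fix r :: real assume "0 < r"
    \<comment> \<open>Both final estimates have error \<open>3 * e\<close>; any fraction of
      \<open>r\<close> below one third would serve.\<close>
    define e where "e = r / 8"
    have e: "0 < e" using \<open>0 < r\<close> by (simp add: e_def)
    have "\<forall>\<^sub>F \<epsilon> in at_right 0. \<bar>J \<epsilon> - L\<bar> < e"
      using tendstoD[OF J e] by (simp add: dist_real_def)
    then obtain b where b: "0 < b" "\<And>\<epsilon>. 0 < \<epsilon> \<Longrightarrow> \<epsilon> < b \<Longrightarrow> \<bar>J \<epsilon> - L\<bar> < e"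
      unfolding eventually_at_right_field by blast
    have distr: "(L + 3 * e) * x = x * (L + e) + 2 * (e * x)" for x :: real by algebra
    \<comment> \<open>A \<open>g\<close> within \<open>e * h n\<close> of the supremum of
      \<open>p n\<close> is within \<open>(2 * K + 3 * e) * h n\<close> of that of
      \<open>p0\<close>: \<open>K + e\<close> for each passage between \<open>p n\<close> and
      \<open>p0\<close>, and \<open>e\<close> for its own defect. Since also
      \<open>e \<le> c\<close>, the one threshold \<open>b / c\<close> serves both
      tolerances.\<close>
    define c where "c = 2 * K + 4 * e"
    have c: "0 < c" "e \<le> c" using K0 e by (auto simp: c_def)
    have "\<forall>\<^sub>F n in sequentially. h n < b / c"
      using order_tendstoD(2)[OF h(2), of "b / c"] b c by simp
    with unif[OF e] have "\<forall>\<^sub>F n in sequentially.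
        \<bar>((SUP g\<in>G. p n g) - S0) / h n - L\<bar> < r"
    proof eventually_elim
      case (elim n)
      let ?S = "SUP g\<in>G. p n g" and ?h = "h n"
      have hp: "0 < ?h" by (rule h)
      have hb: "?h * c < b" using elim(2) c by (simp add: field_simps)
      have up: "p n g \<le> p0 g + ?h * I g + e * ?h" and lo: "p0 g + ?h * I g - e * ?h \<le> p n g"
        if "g \<in> G" for g
        using elim(1) that by (force simp: abs_le_iff)+
      have hI: "\<bar>?h * I g\<bar> \<le> ?h * K" if "g \<in> G" for g
        using K[OF that] hp by (simp add: abs_mult)
      have "?h * e \<le> ?h * c" using c hp by simp
      then have Je: "\<bar>J (e * ?h) - L\<bar> < e"
        using b(2)[of "e * ?h"] hb mult_pos_pos[OF e hp] mult.commute[of e ?h] by linarith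
      \<comment> \<open>Lower bound: each \<open>e * h n\<close>-maximizer of \<open>p0\<close>
        competes in the supremum of \<open>p n\<close>.\<close>
      have "J (e * ?h) \<le> (?S - S0) / ?h + 2 * e"
        unfolding J_eq
      proof (rule cSUP_least)
        show "{g \<in> G. S0 - e * ?h \<le> p0 g} \<noteq> {}" using neJ e hp by simp
      next
        fix g assume "g \<in> {g \<in> G. S0 - e * ?h \<le> p0 g}"
        then have "g \<in> G" "S0 - e * ?h \<le> p0 g" by auto
        with lo[of g] p_le[of g n] have "?h * I g \<le> ?S - S0 + 2 * (e * ?h)" by linarith
        moreover have "((?S - S0) / ?h + 2 * e) * ?h = ?S - S0 + 2 * (e * ?h)"
          using hp by (simp add: distrib_right)
        ultimately have "I g * ?h \<le> ((?S - S0) / ?h + 2 * e) * ?h"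
          by (simp add: mult.commute)
        then show "I g \<le> (?S - S0) / ?h + 2 * e"
          using hp by (simp only: mult_le_cancel_right)
      qed
      with Je have low: "L - 3 * e < (?S - S0) / ?h" by linarith
      \<comment> \<open>Upper bound: \<open>p n\<close> need not attain its supremum, so a near
        maximizer is taken and shown to be nearly maximal for \<open>p0\<close> too.\<close>
      have "?S - e * ?h < ?S" using mult_pos_pos[OF e hp] by linarith
      from less_cSUP_iff[OF ne bdd, THEN iffD1, OF this]
      obtain g where g: "g \<in> G" "?S - e * ?h < p n g" by (elim bexE)
      have "S0 \<le> ?S + ?h * K + e * ?h"
        unfolding S0_def
      proof (rule cSUP_least[OF ne])
        fix g' assume "g' \<in> G"
        then show "p0 g' \<le> ?S + ?h * K + e * ?h"
          using lo[of g'] hI[of g'] p_le[of g' n] by linarith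
      qed
      moreover have "?h * c = 2 * (?h * K) + 4 * (e * ?h)"
        by (simp add: c_def algebra_simps)
      moreover have "0 < e * ?h" using e hp by (rule mult_pos_pos)
      ultimately have "S0 - ?h * c \<le> p0 g"
        using g(2) up[OF g(1)] hI[OF g(1)] by linarith
      with g(1) have "I g \<le> J (?h * c)" by (rule I_le_J)
      also have "\<dots> < L + e" using b(2)[OF mult_pos_pos[OF hp c(1)] hb] by linarith
      finally have "?h * I g \<le> ?h * (L + e)"
        by (intro mult_left_mono less_imp_le[OF hp]) simp
      then have "?S - S0 \<le> (L + 3 * e) * ?h"
        using g(2) up[OF g(1)] p0_le[OF g(1)] distr[of ?h] by linarith
      with hp have "(?S - S0) / ?h \<le> L + 3 * e" by (simp only: pos_divide_le_eq)
      with low \<open>0 < r\<close> show ?case unfolding e_def by linarith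
    qed
    then show "\<forall>\<^sub>F n in sequentially. dist (((SUP g\<in>G. p n g) - S0) / h n) L < r"
      by (simp add: dist_real_def)
  qed
qed

lemma mono_tendsto_at_right_INF:
  fixes J :: "real \<Rightarrow> real"
  assumes mono: "\<And>x y. 0 < x \<Longrightarrow> x \<le> y \<Longrightarrow> J x \<le> J y" and bdd: "bdd_below (J ` {0<..})"
  shows "(J \<longlongrightarrow> (INF x\<in>{0<..}. J x)) (at_right 0)"
proof (rule decreasing_tendsto)
  show "\<forall>\<^sub>F x in at_right 0. (INF x\<in>{0<..}. J x) \<le> J x"
    using cINF_lower[OF bdd] by (intro eventually_at_rightI[of _ 1]) auto
  fix y assume "(INF x\<in>{0<..}. J x) < y"
  then obtain x where "0 < x" "J x < y"
    using cINF_less_iff[of "{0::real<..}" J y] bdd by auto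
  then show "\<forall>\<^sub>F x in at_right 0. J x < y"
    using mono by (intro eventually_at_rightI[of _ x]) (auto intro: le_less_trans[of _ "J x"])
qed

section \<open>Distortion risk functionals as integrals\<close>

text \<open>By right continuity, \<open>v\<close> is the pointwise limit of \<open>v\<close>
  evaluated at the next grid point strictly to the right; each of these functions takes countably
  many values.\<close>

lemma cadlag_borel_measurable:
  assumes "cadlag v"
  shows "v \<in> borel_measurable borel"
proof (rule borel_measurable_LIMSEQ_real)
  define u where "u n x = (of_int \<lfloor>real (Suc n) * x\<rfloor> + 1) / real (Suc n)" for n and x :: real
  have u1: "x < u n x" and u2: "u n x \<le> x + 1 / real (Suc n)" for n x
  proof -
    have "real (Suc n) * x < of_int \<lfloor>real (Suc n) * x\<rfloor> + 1"
      and "of_int \<lfloor>real (Suc n) * x\<rfloor> \<le> real (Suc n) * x" by linarith+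
    then show "x < u n x" "u n x \<le> x + 1 / real (Suc n)"
      by (auto simp: u_def field_simps simp del: of_nat_Suc)
  qed
  show "(\<lambda>n. v (u n x)) \<longlonglongrightarrow> v x" for x
  proof -
    have "(\<lambda>n. u n x) \<longlonglongrightarrow> x"
    proof (rule tendsto_sandwich[of "\<lambda>_. x" _ _ "\<lambda>n. x + 1 / real (Suc n)"])
      show "(\<lambda>n. x + 1 / real (Suc n)) \<longlonglongrightarrow> x"
        using tendsto_add[OF tendsto_const LIMSEQ_inverse_real_of_nat, of x]
        by (simp add: inverse_eq_divide)
    qed (use u1 u2 in \<open>auto intro!: always_eventually less_imp_le simp del: of_nat_Suc\<close>)
    then have "filterlim (\<lambda>n. u n x) (at_right x) sequentially"
    proof (rule filterlim_at_withinI)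
      show "\<forall>\<^sub>F n in sequentially. u n x \<in> {x<..} - {x}"
        by (rule always_eventually, rule allI) (use u1[of x] in simp)
    qed
    moreover have "(v \<longlongrightarrow> v x) (at_right x)"
      using assms by (simp add: cadlag_def continuous_within)
    ultimately show ?thesis by (rule filterlim_compose[rotated])
  qed
  show "(\<lambda>x. v (u n x)) \<in> borel_measurable borel" for n
  proof -
    \<comment> \<open>\<open>u n\<close> factors through the integers, on which every function is
      measurable.\<close>
    have "(\<lambda>x. \<lfloor>real (Suc n) * x\<rfloor>) \<in> borel \<rightarrow>\<^sub>M count_space UNIV"
      by measurable
    then show ?thesis
      unfolding u_def by (rule measurable_compose) simp
  qed
qed

text \<open>By Tonelli, the integral of the tail probability of \<open>X\<close> over the positive
  half-line is the expectation of the positive part of \<open>X\<close>.\<close>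

lemma (in prob_space) nn_integral_tail_finite:
  assumes X: "integrable M X"
  shows "(\<integral>\<^sup>+x\<in>{0..}. ennreal (1 - cdf (distr M borel X) x) \<partial>lborel) < \<infinity>"
proof -
  have [measurable]: "X \<in> borel_measurable M" using X by simp
  interpret D: prob_space "distr M borel X" by (rule prob_space_distr) simp
  interpret P: pair_sigma_finite M lborel ..
  have "ennreal (1 - cdf (distr M borel X) x) = (\<integral>\<^sup>+\<omega>. indicator {x<..} (X \<omega>) \<partial>M)" for x
  proof -
    have "1 - cdf (distr M borel X) x = measure (distr M borel X) {x<..}"
      using D.prob_compl[of "{..x}"] by (simp add: cdf_def Compl_eq_Diff_UNIV[symmetric] Compl_atMost)
    also have "ennreal \<dots> = emeasure (distr M borel X) {x<..}"
      by (simp add: D.emeasure_eq_measure)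
    also have "\<dots> = (\<integral>\<^sup>+y. indicator {x<..} y \<partial>distr M borel X)" by simp
    also have "\<dots> = (\<integral>\<^sup>+\<omega>. indicator {x<..} (X \<omega>) \<partial>M)"
      by (rule nn_integral_distr) simp_all
    finally show ?thesis .
  qed
  then have "(\<integral>\<^sup>+x\<in>{0..}. ennreal (1 - cdf (distr M borel X) x) \<partial>lborel)
      = (\<integral>\<^sup>+x. (\<integral>\<^sup>+\<omega>. indicator {x<..} (X \<omega>) * indicator {0..} x \<partial>M) \<partial>lborel)"
    by (simp add: nn_integral_multc)
  also have "\<dots> = (\<integral>\<^sup>+\<omega>. (\<integral>\<^sup>+x. indicator {x<..} (X \<omega>) * indicator {0..} x \<partial>lborel) \<partial>M)"
  proof (rule P.Fubini')
    have "(\<lambda>(\<omega>, x). indicator {x<..} (X \<omega>) * indicator {0..} x)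
        = (\<lambda>p. if snd p < X (fst p) \<and> 0 \<le> snd p then 1 else 0 :: ennreal)"
      by (auto simp: fun_eq_iff)
    then show "(\<lambda>(\<omega>, x). indicator {x<..} (X \<omega>) * indicator {0..} x :: ennreal)
        \<in> borel_measurable (M \<Otimes>\<^sub>M lborel)"
      by simp
  qed
  also have "\<dots> = (\<integral>\<^sup>+\<omega>. emeasure lborel {0..<X \<omega>} \<partial>M)"
  proof (rule nn_integral_cong)
    fix \<omega>
    have "(\<integral>\<^sup>+x. indicator {x<..} (X \<omega>) * indicator {0..} x \<partial>lborel)
        = (\<integral>\<^sup>+x. indicator {0..<X \<omega>} x \<partial>lborel)"
      by (rule nn_integral_cong) (auto split: split_indicator)
    then show "(\<integral>\<^sup>+x. indicator {x<..} (X \<omega>) * indicator {0..} x \<partial>lborel) = emeasure lborel {0..<X \<omega>}"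
      by simp
  qed
  also have "\<dots> \<le> (\<integral>\<^sup>+\<omega>. ennreal (norm (X \<omega>)) \<partial>M)"
  proof (rule nn_integral_mono)
    fix \<omega>
    have "emeasure lborel {0..<X \<omega>} \<le> emeasure lborel {0..\<bar>X \<omega>\<bar>}"
      by (rule emeasure_mono) auto
    also have "\<dots> = ennreal (norm (X \<omega>))" by simp
    finally show "emeasure lborel {0..<X \<omega>} \<le> ennreal (norm (X \<omega>))" .
  qed
  also have "\<dots> < \<infinity>" using X by (simp add: integrable_iff_bounded)
  finally show ?thesis .
qed

text \<open>A single integral lets differences of risks be taken under the integral sign.
  \<open>fin\<close> makes the left half integrable, \<open>tail\<close> together with
  \<open>t \<le> g t\<close> the right half.\<close>

lemma distortion_risk_eq_integral:
  assumes g: "distortion_function g" "\<And>t. 0 \<le> t \<Longrightarrow> t \<le> 1 \<Longrightarrow> t \<le> g t"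
    and F: "mono F" "\<And>x. 0 \<le> F x \<and> F x \<le> 1"
    and tail: "(\<integral>\<^sup>+x\<in>{0..}. ennreal (1 - F x) \<partial>lborel) < \<infinity>"
    and fin: "distortion_risk g F \<noteq> \<infinity>"
  shows "integrable lborel (\<lambda>x. g (F x) - indicator {0..} x)"
    and "distortion_risk g F = ereal (\<integral>x. g (F x) - indicator {0..} x \<partial>lborel)"
proof -
  have g01: "0 \<le> g (F x) \<and> g (F x) \<le> 1" for x
    using g(1) F(2)[of x] by (auto simp: distortion_function_def)
  have "mono (\<lambda>x. g (F x))"
    using g(1) F by (auto simp: distortion_function_def mono_on_def mono_def)
  then have gF[measurable]: "(\<lambda>x. g (F x)) \<in> borel_measurable borel"
    by (rule borel_measurable_mono)
  have [measurable]: "F \<in> borel_measurable borel" by (rule borel_measurable_mono[OF F(1)])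
  let ?A = "\<integral>\<^sup>+x\<in>{..0}. ennreal (g (F x)) \<partial>lborel"
  let ?B = "\<integral>\<^sup>+x\<in>{0..}. ennreal (1 - g (F x)) \<partial>lborel"
  let ?u = "\<lambda>x. g (F x) * indicator {..0} x" and ?w = "\<lambda>x. (1 - g (F x)) * indicator {0..} x"
  have A: "?A = (\<integral>\<^sup>+x. ennreal (?u x) \<partial>lborel)"
    by (rule nn_integral_cong) (auto split: split_indicator)
  have B: "?B = (\<integral>\<^sup>+x. ennreal (?w x) \<partial>lborel)"
    by (rule nn_integral_cong) (auto split: split_indicator)
  \<comment> \<open>In \<open>ereal\<close>, infinity minus anything, even infinity, is
    infinity.\<close>
  have "?A \<noteq> \<infinity>" using fin by (auto simp: distortion_risk_def)
  then have u: "integrable lborel ?u"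
    using A g01 by (intro integrableI_nonneg) (auto simp: less_top)
  have "?B \<le> (\<integral>\<^sup>+x\<in>{0..}. ennreal (1 - F x) \<partial>lborel)"
    using g(2) F(2) by (intro nn_integral_mono mult_right_mono ennreal_leI) auto
  with tail have "?B < \<infinity>" by (rule le_less_trans[rotated])
  then have w: "integrable lborel ?w"
    using B g01 by (intro integrableI_nonneg) auto
  \<comment> \<open>The two half-lines overlap in the single point \<open>0\<close>.\<close>
  have ae: "AE x in lborel. ?u x - ?w x = g (F x) - indicator {0..} x"
    using AE_lborel_singleton[of "0::real"] by eventually_elim (auto split: split_indicator)
  have i: "integrable lborel (\<lambda>x. ?u x - ?w x)" using u w by simp
  then show "integrable lborel (\<lambda>x. g (F x) - indicator {0..} x)"
    by (rule integrable_cong_AE_imp) (use ae in \<open>auto elim: eventually_mono\<close>)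
  have "(\<integral>x. g (F x) - indicator {0..} x \<partial>lborel) = (\<integral>x. ?u x - ?w x \<partial>lborel)"
    using ae by (intro integral_cong_AE) (auto elim: eventually_mono)
  also have "\<dots> = (\<integral>x. ?u x \<partial>lborel) - (\<integral>x. ?w x \<partial>lborel)"
    using u w by (rule Bochner_Integration.integral_diff)
  finally have "(\<integral>x. g (F x) - indicator {0..} x \<partial>lborel) = (\<integral>x. ?u x \<partial>lborel) - (\<integral>x. ?w x \<partial>lborel)" .
  moreover have "?A = ennreal (\<integral>x. ?u x \<partial>lborel)" "?B = ennreal (\<integral>x. ?w x \<partial>lborel)"
    unfolding A B using u w g01 by (auto intro!: nn_integral_eq_integral)
  moreover have "0 \<le> (\<integral>x. ?u x \<partial>lborel)" "0 \<le> (\<integral>x. ?w x \<partial>lborel)"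
    using g01 by (auto intro!: integral_nonneg_AE)
  ultimately show "distortion_risk g F = ereal (\<integral>x. g (F x) - indicator {0..} x \<partial>lborel)"
    by (simp add: distortion_risk_def)
qed

text \<open>Both modes of convergence are returned: the pointwise one feeds dominated convergence,
  the topological one the continuity of the risk in \<open>g\<close>.\<close>

lemma compactin_uniform_subsequence:
  assumes "compactin uniform_topology G" "\<And>n. gs n \<in> G"
  obtains g r where "g \<in> G" "strict_mono (r :: nat \<Rightarrow> nat)"
    "limitin uniform_topology (gs \<circ> r) g sequentially"
    "\<forall>t\<in>{0..1}. (\<lambda>n. gs (r n) t) \<longlonglongrightarrow> g t"
proof -
  let ?m = "cfunspace (top_of_set {0..1::real}) (euclidean_metric :: real metric)"
  interpret C: Metric_space "mspace ?m" "mdist ?m" by (rule Metric_space_mspace_mdist)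
  have eq: "uniform_topology = C.mtopology" by (simp add: mtopology_of_def)
  have "range gs \<subseteq> G" using assms(2) by auto
  then obtain g r where gr: "g \<in> G" "strict_mono (r :: nat \<Rightarrow> nat)" "limitin C.mtopology (gs \<circ> r) g sequentially"
    using assms(1) unfolding eq C.compactin_sequentially by meson
  have "(\<lambda>n. gs (r n) t) \<longlonglongrightarrow> g t" if t: "t \<in> {0..1}" for t
  proof (rule metric_LIMSEQ_I)
    fix e :: real assume "0 < e"
    then obtain N where N: "\<And>n. n \<ge> N \<Longrightarrow> gs (r n) \<in> mspace ?m \<and> mdist ?m (gs (r n)) g < e / 2"
      and g: "g \<in> mspace ?m"
      using gr(3) unfolding C.limit_metric_sequentially by (metis comp_def half_gt_zero)
    have "dist (gs (r n) t) (g t) < e" if "n \<ge> N" for n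
      using mdist_cfunspace_imp_mdist_le[of "gs (r n)" "top_of_set {0..1}" euclidean_metric g "e / 2" t]
        N[OF that] g t \<open>0 < e\<close> by (force simp del: mspace_cfunspace)
    then show "\<exists>N. \<forall>n\<ge>N. dist (gs (r n) t) (g t) < e" by blast
  qed
  with gr show thesis by (intro that[of g r]) (simp_all only: eq, blast)
qed

section \<open>Uniform first-order expansion over a compact family\<close>

text \<open>The analytic core, detached from the probability space. \<open>w\<close> is an
  integrable weight such that \<open>C * w\<close> dominates all integrands once
  \<open>\<bar>v x * \<phi> x\<bar> \<le> C\<close>, uniformly in \<open>g\<close>.\<close>

locale distortion_family =
  fixes G :: "(real \<Rightarrow> real) set" and F0 \<phi> w :: "real \<Rightarrow> real" and a b :: ereal
  assumes concave: "\<And>g. g \<in> G \<Longrightarrow> concave_on {0..1} g"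
    and distortion: "\<And>g. g \<in> G \<Longrightarrow> distortion_function g"
    and compact: "compactin uniform_topology G"
    and G_nonempty: "G \<noteq> {}"
    and F0_mono: "mono F0"
    and F0_range: "\<And>x. 0 \<le> F0 x \<and> F0 x \<le> 1"
    and F0_inside: "\<And>x. x \<in> einterval a b \<Longrightarrow> 0 < F0 x \<and> F0 x < 1"
    and F0_inj: "inj_on F0 (einterval a b)"
    and \<phi>_ge_1: "\<And>x. 1 \<le> \<phi> x"
    and w_integrable: "integrable lborel (\<lambda>x. indicator (einterval a b) x * w x)"
    and w_bound: "\<And>g x. g \<in> G \<Longrightarrow> x \<in> einterval a b \<Longrightarrow> g (F0 x) / F0 x \<le> w x * \<phi> x"
begin

definition deriv_integral :: "(real \<Rightarrow> real) \<Rightarrow> (real \<Rightarrow> real) \<Rightarrow> real" where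
  "deriv_integral g v = (\<integral>x. indicator (einterval a b) x * (right_deriv g (F0 x) * v x) \<partial>lborel)"

text \<open>A Lipschitz constant in the weighted norm, common to all \<open>deriv_integral g\<close>
  with \<open>g \<in> G\<close>.\<close>

definition weight_mass :: real where
  "weight_mass = (\<integral>x. indicator (einterval a b) x * w x \<partial>lborel)"

section \<open>Measurability and domination of the integrands\<close>

lemma distortion_nonneg: "0 \<le> g (F0 x) / F0 x" if "g \<in> G"
  using distortion[OF that] F0_range[of x] by (auto simp: distortion_function_def Pi_iff)

lemma w_nonneg: "0 \<le> w x" if "x \<in> einterval a b"
proof -
  obtain g where g: "g \<in> G" using G_nonempty by auto
  have "0 \<le> g (F0 x) / F0 x" by (rule distortion_nonneg[OF g])
  also have "\<dots> \<le> w x * \<phi> x" by (rule w_bound[OF g that])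
  finally show ?thesis using \<phi>_ge_1[of x] by (simp add: zero_le_mult_iff)
qed

lemma weight_mass_nonneg: "0 \<le> weight_mass"
  unfolding weight_mass_def using w_nonneg by (intro integral_nonneg_AE) (auto simp: indicator_def)

text \<open>A nonincreasing function of a nondecreasing one is monotone. The indicator removes
  points where \<open>F0 x\<close> may be \<open>0\<close> or \<open>1\<close> and
  \<open>right_deriv\<close> is not controlled.\<close>

lemma right_deriv_measurable:
  assumes "g \<in> G"
  shows "(\<lambda>x. indicator (einterval a b) x * right_deriv g (F0 x)) \<in> borel_measurable borel"
proof -
  have "mono_on (einterval a b) (\<lambda>x. - right_deriv g (F0 x))"
    using right_deriv_antimono[OF concave[OF assms]] F0_inside monoD[OF F0_mono]
    by (intro mono_onI) (simp del: einterval_iff)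
  then have "(\<lambda>x. - right_deriv g (F0 x)) \<in> borel_measurable (restrict_space borel (einterval a b))"
    by (rule borel_measurable_mono_on_fnc)
  then have "(\<lambda>x. indicator (einterval a b) x *\<^sub>R (- right_deriv g (F0 x))) \<in> borel_measurable borel"
    by (subst (asm) borel_measurable_restrict_space_iff) simp_all
  from borel_measurable_uminus[OF this] show ?thesis by simp
qed

lemma integrand_measurable:
  assumes "g \<in> G" "v \<in> borel_measurable borel"
  shows "(\<lambda>x. indicator (einterval a b) x * (right_deriv g (F0 x) * v x)) \<in> borel_measurable lborel"
  using borel_measurable_times[OF right_deriv_measurable[OF assms(1)] assms(2)]
  by (simp add: mult.assoc)

text \<open>\<open>r\<close> stands for the right derivative in the limit integrals and for the
  secant slope \<open>g (F0 x) / F0 x\<close> in the difference quotients, so both get the same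
  majorant.\<close>

lemma scaled_bound:
  assumes g: "g \<in> G" and x: "x \<in> einterval a b" and "0 \<le> r" "r \<le> g (F0 x) / F0 x" "\<bar>y * \<phi> x\<bar> \<le> C"
  shows "\<bar>r * y\<bar> \<le> C * w x"
proof -
  have "\<bar>r * y\<bar> = r * \<bar>y\<bar>" using assms by (simp add: abs_mult)
  also have "\<dots> \<le> (w x * \<phi> x) * \<bar>y\<bar>"
    using assms w_bound[OF g x] by (intro mult_right_mono) auto
  also have "\<dots> = w x * \<bar>y * \<phi> x\<bar>" using \<phi>_ge_1[of x] by (simp add: abs_mult)
  also have "\<dots> \<le> w x * C" using assms w_nonneg[OF x] by (intro mult_left_mono) auto
  finally show ?thesis by (simp add: mult.commute)
qed

lemma integrand_bound:
  assumes "g \<in> G" "\<And>x. \<bar>v x * \<phi> x\<bar> \<le> C"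
  shows "norm (indicator (einterval a b) x * (right_deriv g (F0 x) * v x))
    \<le> C * (indicator (einterval a b) x * w x)"
  using scaled_bound[where x = x and r = "right_deriv g (F0 x)", OF assms(1) _ _ _ assms(2)]
    right_deriv_distortion_bounds[OF concave distortion, OF assms(1) assms(1), of "F0 x"] F0_inside[of x]
  by (cases "x \<in> einterval a b") (simp_all del: einterval_iff)

lemma integrand_integrable:
  assumes g: "g \<in> G" and v: "v \<in> borel_measurable borel" "\<And>x. \<bar>v x * \<phi> x\<bar> \<le> C"
  shows "integrable lborel (\<lambda>x. indicator (einterval a b) x * (right_deriv g (F0 x) * v x))"
proof (rule Bochner_Integration.integrable_bound)
  show "integrable lborel (\<lambda>x. C * (indicator (einterval a b) x * w x))"
    using w_integrable by simp
  show "AE x in lborel. norm (indicator (einterval a b) x * (right_deriv g (F0 x) * v x))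
      \<le> norm (C * (indicator (einterval a b) x * w x))"
    by (intro always_eventually allI) (simp only: real_norm_def order_trans[OF integrand_bound[OF g v(2), unfolded real_norm_def] abs_ge_self])
qed (rule integrand_measurable[OF g v(1)])

lemma deriv_integral_bound:
  assumes g: "g \<in> G" and v: "v \<in> borel_measurable borel" "\<And>x. \<bar>v x * \<phi> x\<bar> \<le> C"
  shows "\<bar>deriv_integral g v\<bar> \<le> C * weight_mass"
proof -
  have "norm (deriv_integral g v) \<le> (\<integral>x. C * (indicator (einterval a b) x * w x) \<partial>lborel)"
    unfolding deriv_integral_def
  proof (rule Bochner_Integration.integral_norm_bound_integral)
    show "integrable lborel (\<lambda>x. C * (indicator (einterval a b) x * w x))"
      using w_integrable by simp
  qed (rule integrand_integrable[OF g v], rule integrand_bound[OF g v(2)])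
  then show ?thesis by (simp add: weight_mass_def)
qed

lemma deriv_integral_diff:
  assumes g: "g \<in> G" and v: "v \<in> borel_measurable borel" "\<And>x. \<bar>v x * \<phi> x\<bar> \<le> C"
    and u: "u \<in> borel_measurable borel" "\<And>x. \<bar>u x * \<phi> x\<bar> \<le> D"
  shows "deriv_integral g (\<lambda>x. v x - u x) = deriv_integral g v - deriv_integral g u"
  unfolding deriv_integral_def
  by (subst Bochner_Integration.integral_diff[symmetric])
    (simp_all add: integrand_integrable[OF g v] integrand_integrable[OF g u] right_diff_distrib)

text \<open>Injectivity of \<open>F0\<close> pulls the countable set of discontinuities back to a
  countable, hence null, set.\<close>

lemma AE_isCont_right_deriv:
  assumes "g \<in> G"
  shows "AE x in lborel. x \<in> einterval a b \<longrightarrow> isCont (right_deriv g) (F0 x)"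
proof -
  have "countable {x \<in> einterval a b. F0 x \<in> {t\<in>{0<..<1}. \<not> isCont (right_deriv g) t}}"
    by (rule countable_image_inj_gen[OF F0_inj countable_right_deriv_discont[OF concave[OF assms]]])
  then have "{x \<in> einterval a b. F0 x \<in> {t\<in>{0<..<1}. \<not> isCont (right_deriv g) t}} \<in> null_sets lborel"
    by (rule countable_imp_null_set_lborel)
  from AE_not_in[OF this] show ?thesis
    by eventually_elim (use F0_inside in \<open>auto simp del: einterval_iff\<close>)
qed

text \<open>Continuity in \<open>g\<close>: for concave functions pointwise convergence forces
  convergence of the right derivatives wherever the limit derivative is continuous, and the majorant
  does not depend on \<open>n\<close>.\<close>

lemma deriv_integral_tendsto:
  assumes gs: "\<And>n. gs n \<in> G" and g: "g \<in> G"
    and lim: "\<And>t. t \<in> {0..1} \<Longrightarrow> (\<lambda>n. gs n t) \<longlonglongrightarrow> g t"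
    and v: "v \<in> borel_measurable borel" "\<And>x. \<bar>v x * \<phi> x\<bar> \<le> C"
  shows "(\<lambda>n. deriv_integral (gs n) v) \<longlonglongrightarrow> deriv_integral g v"
  unfolding deriv_integral_def
proof (rule integral_dominated_convergence)
  show "integrable lborel (\<lambda>x. C * (indicator (einterval a b) x * w x))"
    using w_integrable by simp
  show "AE x in lborel. norm (indicator (einterval a b) x * (right_deriv (gs n) (F0 x) * v x))
      \<le> C * (indicator (einterval a b) x * w x)" for n
    using integrand_bound[OF gs v(2)] by simp
  show "AE x in lborel. (\<lambda>n. indicator (einterval a b) x * (right_deriv (gs n) (F0 x) * v x))
      \<longlonglongrightarrow> indicator (einterval a b) x * (right_deriv g (F0 x) * v x)"
    using AE_isCont_right_deriv[OF g]
  proof eventually_elim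
    case (elim x)
    show ?case
    proof (cases "x \<in> einterval a b")
      case True
      with elim have cont: "isCont (right_deriv g) (F0 x)" by simp
      from F0_inside[OF True] have t: "0 < F0 x" "F0 x < 1" by auto
      have "(\<lambda>n. right_deriv (gs n) (F0 x)) \<longlonglongrightarrow> right_deriv g (F0 x)"
      proof (rule LIMSEQ_I)
        fix e :: real assume "0 < e"
        then have "0 < e / 2" by simp
        obtain d where near: "\<forall>\<^sub>F n in sequentially.
            \<bar>right_deriv (gs n) (F0 x) - right_deriv g (F0 x)\<bar> \<le> e / 2 \<and>
            (\<forall>s\<in>{0..1}. \<bar>s - F0 x\<bar> < d \<longrightarrow>
              \<bar>gs n s - gs n (F0 x) - right_deriv g (F0 x) * (s - F0 x)\<bar> \<le> e / 2 * \<bar>s - F0 x\<bar>)"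
          by (rule concave_seq_slopes_near[OF concave[OF gs] concave[OF g] lim t cont \<open>0 < e / 2\<close>])
        have "\<forall>\<^sub>F n in sequentially. \<bar>right_deriv (gs n) (F0 x) - right_deriv g (F0 x)\<bar> \<le> e / 2"
          by (rule eventually_mono[OF near]) (erule conjunct1)
        then obtain N where N: "\<And>n. N \<le> n \<Longrightarrow> \<bar>right_deriv (gs n) (F0 x) - right_deriv g (F0 x)\<bar> \<le> e / 2"
          unfolding eventually_sequentially by blast
        have "norm (right_deriv (gs n) (F0 x) - right_deriv g (F0 x)) < e" if "N \<le> n" for n
          using N[OF that] \<open>0 < e\<close> by simp
        then show "\<exists>N. \<forall>n\<ge>N. norm (right_deriv (gs n) (F0 x) - right_deriv g (F0 x)) < e"
          by blast
      qed
      then show ?thesis by (intro tendsto_intros)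
    qed simp
  qed
qed (use integrand_measurable gs g v(1) in auto)

lemma composed_measurable:
  fixes F :: "real \<Rightarrow> real"
  assumes "g \<in> G" "mono F" "\<And>x. 0 \<le> F x \<and> F x \<le> 1"
  shows "(\<lambda>x. g (F x)) \<in> borel_measurable borel"
proof -
  have "mono (\<lambda>x. g (F x))"
    using distortion[OF assms(1)] assms(2,3) by (auto simp: distortion_function_def mono_on_def mono_def)
  then show ?thesis by (rule borel_measurable_mono)
qed

text \<open>The distortion and the increment vary simultaneously. The slope estimate uniform in
  \<open>s\<close> is what allows inserting the moving point \<open>Fs n x\<close>.\<close>

lemma difference_quotient_tendsto:
  assumes gs: "\<And>n. gs n \<in> G" and g: "g \<in> G"
    and lim: "\<And>t. t \<in> {0..1} \<Longrightarrow> (\<lambda>n. gs n t) \<longlonglongrightarrow> g t"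
    and Fs: "\<And>n. mono (Fs n)" "\<And>n x. 0 \<le> Fs n x \<and> Fs n x \<le> 1"
    and eq: "\<And>n x. Fs n x = F0 x + h n * vs n x"
    and h: "\<And>n. 0 < h n" "h \<longlonglongrightarrow> 0"
    and vs: "\<And>n x. \<bar>vs n x * \<phi> x\<bar> \<le> C" "\<And>x. (\<lambda>n. vs n x) \<longlonglongrightarrow> v x"
    and v: "v \<in> borel_measurable borel"
  shows "(\<lambda>n. \<integral>x. indicator (einterval a b) x * ((gs n (Fs n x) - gs n (F0 x)) / h n) \<partial>lborel)
    \<longlonglongrightarrow> deriv_integral g v"
  unfolding deriv_integral_def
proof (rule integral_dominated_convergence)
  show "integrable lborel (\<lambda>x. C * (indicator (einterval a b) x * w x))"
    using w_integrable by simp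
  show "AE x in lborel. norm (indicator (einterval a b) x * ((gs n (Fs n x) - gs n (F0 x)) / h n))
      \<le> C * (indicator (einterval a b) x * w x)" for n
  proof (intro always_eventually allI)
    fix x
    show "norm (indicator (einterval a b) x * ((gs n (Fs n x) - gs n (F0 x)) / h n))
      \<le> C * (indicator (einterval a b) x * w x)"
    proof (cases "x \<in> einterval a b")
      case True
      let ?q = "gs n (F0 x) / F0 x"
      \<comment> \<open>The secant slope is taken at the fixed point \<open>F0 x\<close>, so the
        bound holds wherever \<open>Fs n x\<close> lies in \<open>[0, 1]\<close>.\<close>
      have "\<bar>gs n (Fs n x) - gs n (F0 x)\<bar> \<le> \<bar>Fs n x - F0 x\<bar> * ?q"
        using F0_inside[OF True] Fs(2)[of n x]
        by (intro concave_distortion_lipschitz_at concave distortion gs) auto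
      also have "\<dots> = h n * (?q * \<bar>vs n x\<bar>)"
        using h(1)[of n] by (simp add: eq abs_mult)
      finally have "\<bar>gs n (Fs n x) - gs n (F0 x)\<bar> / h n \<le> ?q * \<bar>vs n x\<bar>"
        using h(1)[of n] by (simp add: pos_divide_le_eq mult.commute)
      moreover have q: "0 \<le> ?q" by (rule distortion_nonneg[OF gs])
      then have "\<bar>?q * vs n x\<bar> \<le> C * w x"
        by (intro scaled_bound[OF gs True _ _ vs(1)]) auto
      then have "?q * \<bar>vs n x\<bar> \<le> C * w x" using q by (simp only: abs_mult abs_of_nonneg)
      ultimately show ?thesis using True h(1)[of n] by (simp del: einterval_iff)
    qed simp
  qed
  show "(\<lambda>x. indicator (einterval a b) x * ((gs n (Fs n x) - gs n (F0 x)) / h n))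
      \<in> borel_measurable lborel" for n
    using composed_measurable[OF gs Fs] composed_measurable[OF gs F0_mono F0_range] by simp
  show "AE x in lborel. (\<lambda>n. indicator (einterval a b) x * ((gs n (Fs n x) - gs n (F0 x)) / h n))
      \<longlonglongrightarrow> indicator (einterval a b) x * (right_deriv g (F0 x) * v x)"
    using AE_isCont_right_deriv[OF g]
  proof eventually_elim
    case (elim x)
    show ?case
    proof (cases "x \<in> einterval a b")
      case True
      let ?t = "F0 x" and ?r = "right_deriv g (F0 x)"
      from elim True have cont: "isCont (right_deriv g) (F0 x)" by simp
      from F0_inside[OF True] have t: "0 < F0 x" "F0 x < 1" by auto
      have vs_le: "\<bar>vs n x\<bar> \<le> C" for n
      proof -
        have "\<bar>vs n x\<bar> * 1 \<le> \<bar>vs n x\<bar> * \<phi> x" using \<phi>_ge_1 by (intro mult_left_mono) auto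
        also have "\<dots> = \<bar>vs n x * \<phi> x\<bar>" using \<phi>_ge_1[of x] by (simp add: abs_mult)
        finally show ?thesis using vs(1)[of n x] by simp
      qed
      then have C: "0 \<le> C" using abs_ge_zero order_trans by blast
      have "(\<lambda>n. h n * vs n x) \<longlonglongrightarrow> 0 * v x" by (intro tendsto_mult h vs)
      then have small: "(\<lambda>n. h n * vs n x) \<longlonglongrightarrow> 0" by simp
      have "(\<lambda>n. (gs n (Fs n x) - gs n ?t) / h n - ?r * vs n x) \<longlonglongrightarrow> 0"
      proof (rule LIMSEQ_I)
        fix e :: real assume "0 < e"
        \<comment> \<open>The summand \<open>1\<close> covers the case \<open>C = 0\<close>.\<close>
        define e' where "e' = e / (C + 1)"
        have e': "0 < e'" "e' * C < e" using \<open>0 < e\<close> C by (auto simp: e'_def field_simps)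
        obtain d where d: "0 < d" "\<forall>\<^sub>F n in sequentially.
            \<bar>right_deriv (gs n) ?t - ?r\<bar> \<le> e' \<and> (\<forall>s\<in>{0..1}. \<bar>s - ?t\<bar> < d \<longrightarrow>
              \<bar>gs n s - gs n ?t - ?r * (s - ?t)\<bar> \<le> e' * \<bar>s - ?t\<bar>)"
          by (rule concave_seq_slopes_near[OF concave[OF gs] concave[OF g] lim t cont e'(1)])
        have "\<forall>\<^sub>F n in sequentially. \<bar>h n * vs n x\<bar> < d"
          using tendstoD[OF small d(1)] by (simp add: dist_real_def)
        with d(2) have "\<forall>\<^sub>F n in sequentially.
            norm ((gs n (Fs n x) - gs n ?t) / h n - ?r * vs n x - 0) < e"
        proof eventually_elim
          case (elim n)
          have hn: "0 < h n" by (rule h)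
          have "\<bar>gs n (Fs n x) - gs n ?t - ?r * (Fs n x - ?t)\<bar> \<le> e' * \<bar>Fs n x - ?t\<bar>"
            using elim(2) Fs(2)[of n x]
            by (intro elim(1)[THEN conjunct2, THEN bspec, rule_format]) (simp_all add: eq)
          then have "\<bar>gs n (Fs n x) - gs n ?t - ?r * (h n * vs n x)\<bar> \<le> e' * (h n * \<bar>vs n x\<bar>)"
            using hn by (simp add: eq abs_mult)
          also have "\<dots> \<le> e' * (h n * C)"
            using e' hn vs_le by (intro mult_left_mono) auto
          finally have "\<bar>gs n (Fs n x) - gs n ?t - ?r * (h n * vs n x)\<bar> / h n \<le> e' * C"
            using hn by (simp add: pos_divide_le_eq mult_ac)
          moreover have "(gs n (Fs n x) - gs n ?t) / h n - ?r * vs n x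
              = (gs n (Fs n x) - gs n ?t - ?r * (h n * vs n x)) / h n"
            using hn by (simp add: diff_divide_distrib)
          ultimately show ?case using e'(2) hn by (simp add: abs_divide)
        qed
        then show "\<exists>N. \<forall>n\<ge>N. norm ((gs n (Fs n x) - gs n ?t) / h n - ?r * vs n x - 0) < e"
          by (simp add: eventually_sequentially)
      qed
      from tendsto_add[OF this tendsto_mult[OF tendsto_const[of ?r] vs(2)[of x]]]
      show ?thesis using True by (simp del: einterval_iff)
    qed simp
  qed
qed (use integrand_measurable g v in auto)

text \<open>If the expansion failed, bad functions \<open>gs n\<close> would exist along a
  subsequence; compactness gives them a limit \<open>g\<close>, and difference quotient and
  derivative both tend to \<open>deriv_integral g v\<close>, so the error vanishes after
  all.\<close>

lemma uniform_expansion: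
  assumes Fs: "\<And>n. mono (Fs n)" "\<And>n x. 0 \<le> Fs n x \<and> Fs n x \<le> 1"
    and eq: "\<And>n x. Fs n x = F0 x + h n * vs n x"
    and h: "\<And>n. 0 < h n" "h \<longlonglongrightarrow> 0"
    and vs: "\<And>n x. \<bar>vs n x * \<phi> x\<bar> \<le> C" "\<And>x. (\<lambda>n. vs n x) \<longlonglongrightarrow> v x"
    and v: "v \<in> borel_measurable borel" "\<And>x. \<bar>v x * \<phi> x\<bar> \<le> D" and e: "0 < e"
  shows "\<forall>\<^sub>F n in sequentially. \<forall>g\<in>G.
    \<bar>(\<integral>x. indicator (einterval a b) x * (g (Fs n x) - g (F0 x)) \<partial>lborel)
      - h n * deriv_integral g v\<bar> \<le> e * h n"
proof (rule ccontr)
  let ?\<Delta> = "\<lambda>n g. \<integral>x. indicator (einterval a b) x * (g (Fs n x) - g (F0 x)) \<partial>lborel"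
  assume "\<not> ?thesis"
  then have "infinite {n. \<exists>g\<in>G. e * h n < \<bar>?\<Delta> n g - h n * deriv_integral g v\<bar>}"
    by (simp add: cofinite_eq_sequentially[symmetric] eventually_cofinite not_le)
  from infinite_enumerate[OF this] obtain \<sigma> :: "nat \<Rightarrow> nat" where \<sigma>: "strict_mono \<sigma>"
    and ex: "\<forall>n. \<exists>g\<in>G. e * h (\<sigma> n) < \<bar>?\<Delta> (\<sigma> n) g - h (\<sigma> n) * deriv_integral g v\<bar>"
    unfolding mem_Collect_eq by (elim exE conjE)
  from ex have "\<exists>gs. \<forall>n. gs n \<in> G \<and>
      e * h (\<sigma> n) < \<bar>?\<Delta> (\<sigma> n) (gs n) - h (\<sigma> n) * deriv_integral (gs n) v\<bar>"
    unfolding Bex_def by (rule choice)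
  then obtain gs where all: "\<forall>n. gs n \<in> G \<and>
      e * h (\<sigma> n) < \<bar>?\<Delta> (\<sigma> n) (gs n) - h (\<sigma> n) * deriv_integral (gs n) v\<bar>" ..
  then have gs: "\<And>n. gs n \<in> G"
    and bad: "\<And>n. e * h (\<sigma> n) < \<bar>?\<Delta> (\<sigma> n) (gs n) - h (\<sigma> n) * deriv_integral (gs n) v\<bar>"
    by simp_all
  obtain g r where g: "g \<in> G" and r: "strict_mono (r :: nat \<Rightarrow> nat)"
    and "limitin uniform_topology (gs \<circ> r) g sequentially"
    and lim_all: "\<forall>t\<in>{0..1}. (\<lambda>n. gs (r n) t) \<longlonglongrightarrow> g t"
    by (rule compactin_uniform_subsequence[where gs = gs, OF compact gs])
  note lim = lim_all[rule_format]
  define \<tau> where "\<tau> n = \<sigma> (r n)" for n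
  have \<tau>: "strict_mono \<tau>" using \<sigma> r by (simp add: strict_mono_def \<tau>_def)
  \<comment> \<open>The derivative is that of the moving \<open>gs (r n)\<close>, as in
    \<open>bad\<close>, and not of the limit \<open>g\<close>.\<close>
  have "(\<lambda>n. (\<integral>x. indicator (einterval a b) x * ((gs (r n) (Fs (\<tau> n) x) - gs (r n) (F0 x)) / h (\<tau> n)) \<partial>lborel)
      - deriv_integral (gs (r n)) v) \<longlonglongrightarrow> deriv_integral g v - deriv_integral g v"
  proof (intro tendsto_diff deriv_integral_tendsto[OF gs g lim v]
      difference_quotient_tendsto[OF gs g lim Fs eq h(1) _ vs(1) _ v(1)])
    show "(\<lambda>n. h (\<tau> n)) \<longlonglongrightarrow> 0" using LIMSEQ_subseq_LIMSEQ[OF h(2) \<tau>] by (simp add: o_def)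
    show "(\<lambda>n. vs (\<tau> n) x) \<longlonglongrightarrow> v x" for x
      using LIMSEQ_subseq_LIMSEQ[OF vs(2)[of x] \<tau>] by (simp add: o_def)
  qed
  then have "(\<lambda>n. ?\<Delta> (\<tau> n) (gs (r n)) / h (\<tau> n) - deriv_integral (gs (r n)) v) \<longlonglongrightarrow> 0"
    by simp
  from tendstoD[OF this e] obtain n
    where n: "\<bar>?\<Delta> (\<tau> n) (gs (r n)) / h (\<tau> n) - deriv_integral (gs (r n)) v\<bar> < e"
    by (auto simp: dist_real_def eventually_sequentially)
  have hn: "0 < h (\<tau> n)" by (rule h)
  have "\<bar>?\<Delta> (\<tau> n) (gs (r n)) - h (\<tau> n) * deriv_integral (gs (r n)) v\<bar>
      = \<bar>?\<Delta> (\<tau> n) (gs (r n)) / h (\<tau> n) - deriv_integral (gs (r n)) v\<bar> * h (\<tau> n)"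
  proof -
    have "?\<Delta> (\<tau> n) (gs (r n)) - h (\<tau> n) * deriv_integral (gs (r n)) v
        = (?\<Delta> (\<tau> n) (gs (r n)) / h (\<tau> n) - deriv_integral (gs (r n)) v) * h (\<tau> n)"
      using hn by (simp only: left_diff_distrib) (simp add: mult.commute)
    then show ?thesis using hn by (simp only: abs_mult abs_of_pos)
  qed
  also have "\<dots> < e * h (\<tau> n)" using n hn by (rule mult_strict_right_mono)
  finally show False using bad[of "r n"] by (simp add: \<tau>_def)
qed

section \<open>The slope of the supremum over almost maximizers\<close>

definition slope_sup :: "((real \<Rightarrow> real) \<Rightarrow> real) \<Rightarrow> (real \<Rightarrow> real) \<Rightarrow> real \<Rightarrow> real" where
  "slope_sup p v \<epsilon> = (SUP g\<in>{g\<in>G. (SUP g\<in>G. p g) - \<epsilon> \<le> p g}. deriv_integral g v)"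

text \<open>The candidate derivative. A smaller tolerance leaves fewer almost maximizers, so the
  limit at \<open>0\<close> is an infimum, which avoids choosing a limit.\<close>

definition sup_derivative :: "((real \<Rightarrow> real) \<Rightarrow> real) \<Rightarrow> (real \<Rightarrow> real) \<Rightarrow> real" where
  "sup_derivative p v = (INF \<epsilon>\<in>{0<..}. slope_sup p v \<epsilon>)"

lemma almost_maximizers_nonempty:
  fixes p :: "(real \<Rightarrow> real) \<Rightarrow> real"
  assumes "bdd_above (p ` G)" "0 < \<epsilon>"
  shows "{g\<in>G. (SUP g\<in>G. p g) - \<epsilon> \<le> p g} \<noteq> {}"
proof -
  have "(SUP g\<in>G. p g) - \<epsilon> < (SUP g\<in>G. p g)" using assms(2) by simp
  from less_cSUP_iff[OF G_nonempty assms(1), THEN iffD1, OF this] show ?thesis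
    by (auto intro: less_imp_le)
qed

lemma bdd_above_deriv_integral:
  assumes "v \<in> borel_measurable borel" "\<And>x. \<bar>v x * \<phi> x\<bar> \<le> C" "A \<subseteq> G"
  shows "bdd_above ((\<lambda>g. deriv_integral g v) ` A)"
proof (rule bdd_aboveI2)
  fix g assume "g \<in> A"
  with assms(3) have "g \<in> G" by auto
  from deriv_integral_bound[OF this assms(1,2)]
  show "deriv_integral g v \<le> C * weight_mass" by (simp add: abs_le_iff)
qed

lemma deriv_integral_le_slope_sup:
  assumes "v \<in> borel_measurable borel" "\<And>x. \<bar>v x * \<phi> x\<bar> \<le> C"
    and "g \<in> G" "(SUP g\<in>G. p g) - \<epsilon> \<le> p g"
  shows "deriv_integral g v \<le> slope_sup p v \<epsilon>"
  unfolding slope_sup_def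
  by (rule cSUP_upper) (use assms(3,4) bdd_above_deriv_integral[OF assms(1,2)] in auto)

lemma slope_sup_tendsto:
  assumes p: "bdd_above (p ` G)" and v: "v \<in> borel_measurable borel" "\<And>x. \<bar>v x * \<phi> x\<bar> \<le> C"
  shows "(slope_sup p v \<longlongrightarrow> sup_derivative p v) (at_right 0)"
  unfolding sup_derivative_def
proof (rule mono_tendsto_at_right_INF)
  fix x y :: real assume xy: "0 < x" "x \<le> y"
  show "slope_sup p v x \<le> slope_sup p v y"
    unfolding slope_sup_def[of p v x]
  proof (rule cSUP_least[OF almost_maximizers_nonempty[OF p xy(1)]])
    fix g assume "g \<in> {g\<in>G. (SUP g\<in>G. p g) - x \<le> p g}"
    then show "deriv_integral g v \<le> slope_sup p v y"
      using xy by (intro deriv_integral_le_slope_sup[OF v]) auto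
  qed
next
  show "bdd_below (slope_sup p v ` {0<..})"
  proof (rule bdd_belowI2)
    fix x :: real assume "x \<in> {0<..}"
    then obtain g where g: "g \<in> G" "(SUP g\<in>G. p g) - x \<le> p g"
      using almost_maximizers_nonempty[OF p, of x] by auto
    from deriv_integral_bound[OF g(1) v] deriv_integral_le_slope_sup[OF v g]
    show "- (C * weight_mass) \<le> slope_sup p v x" by (simp add: abs_le_iff)
  qed
qed

text \<open>\<open>sup_derivative p\<close> need not be linear, so the Lipschitz bound is proved for
  each \<open>g\<close> and passed through supremum and limit.\<close>

lemma sup_derivative_lipschitz:
  assumes p: "bdd_above (p ` G)" and v: "v \<in> borel_measurable borel" "\<And>x. \<bar>v x * \<phi> x\<bar> \<le> C"
    and u: "u \<in> borel_measurable borel" "\<And>x. \<bar>u x * \<phi> x\<bar> \<le> D"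
    and d: "\<And>x. \<bar>(v x - u x) * \<phi> x\<bar> \<le> d"
  shows "sup_derivative p v \<le> sup_derivative p u + d * weight_mass"
proof (rule tendsto_le[OF trivial_limit_at_right_real])
  show "(slope_sup p v \<longlongrightarrow> sup_derivative p v) (at_right 0)" by (rule slope_sup_tendsto[OF p v])
  show "((\<lambda>\<epsilon>. slope_sup p u \<epsilon> + d * weight_mass) \<longlongrightarrow> sup_derivative p u + d * weight_mass) (at_right 0)"
    by (intro tendsto_add tendsto_const slope_sup_tendsto[OF p u])
  have vu: "(\<lambda>x. v x - u x) \<in> borel_measurable borel" using v(1) u(1) by simp
  have "slope_sup p v \<epsilon> \<le> slope_sup p u \<epsilon> + d * weight_mass" if "0 < \<epsilon>" for \<epsilon>
    unfolding slope_sup_def[of p v]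
  proof (rule cSUP_least[OF almost_maximizers_nonempty[OF p that]])
    fix g assume "g \<in> {g\<in>G. (SUP g\<in>G. p g) - \<epsilon> \<le> p g}"
    then have g: "g \<in> G" "(SUP g\<in>G. p g) - \<epsilon> \<le> p g" by auto
    from deriv_integral_bound[OF g(1) vu d] deriv_integral_diff[OF g(1) v u]
      deriv_integral_le_slope_sup[OF u g]
    show "deriv_integral g v \<le> slope_sup p u \<epsilon> + d * weight_mass" by (simp add: abs_le_iff)
  qed
  then show "\<forall>\<^sub>F \<epsilon> in at_right 0. slope_sup p v \<epsilon> \<le> slope_sup p u \<epsilon> + d * weight_mass"
    by (intro eventually_at_rightI[of 0 1]) auto
qed

lemma sup_derivative_le_slope_sup:
  assumes p: "bdd_above (p ` G)" and v: "v \<in> borel_measurable borel" "\<And>x. \<bar>v x * \<phi> x\<bar> \<le> C"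
    and g: "g \<in> G" "p g = (SUP g\<in>G. p g)"
  shows "deriv_integral g v \<le> sup_derivative p v"
  unfolding sup_derivative_def
proof (rule cINF_greatest)
  fix \<epsilon> :: real assume "\<epsilon> \<in> {0<..}"
  with g show "deriv_integral g v \<le> slope_sup p v \<epsilon>"
    by (intro deriv_integral_le_slope_sup[OF v]) auto
qed auto

text \<open>Almost maximizers with almost maximal slope accumulate at some \<open>g\<close>.
  Continuity of the risk makes \<open>g\<close> an exact maximizer, and continuity of
  \<open>deriv_integral\<close> in \<open>g\<close> keeps its slope.\<close>

lemma maximizer_attaining_sup_derivative:
  assumes p: "bdd_above (p ` G)" and v: "v \<in> borel_measurable borel" "\<And>x. \<bar>v x * \<phi> x\<bar> \<le> C"
    and cont: "continuous_map (subtopology uniform_topology G) euclidean f"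
    and f: "\<And>g. g \<in> G \<Longrightarrow> f g = ereal (p g)"
  obtains g where "g \<in> G" "p g = (SUP g\<in>G. p g)" "sup_derivative p v \<le> deriv_integral g v"
proof -
  let ?S = "SUP g\<in>G. p g"
  define \<delta> where "\<delta> n = inverse (real (Suc n))" for n
  have \<delta>: "0 < \<delta> n" for n by (simp add: \<delta>_def)
  have \<delta>0: "\<delta> \<longlonglongrightarrow> 0" unfolding \<delta>_def by (rule LIMSEQ_inverse_real_of_nat)
  have "\<exists>g. g \<in> G \<and> ?S - \<delta> n \<le> p g \<and> slope_sup p v (\<delta> n) - \<delta> n < deriv_integral g v" for n
  proof -
    have "bdd_above ((\<lambda>g. deriv_integral g v) ` {g\<in>G. ?S - \<delta> n \<le> p g})"
      by (rule bdd_above_deriv_integral[OF v]) auto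
    note less_cSUP_iff[OF almost_maximizers_nonempty[OF p \<delta>] this, THEN iffD1]
    moreover have "slope_sup p v (\<delta> n) - \<delta> n < (SUP g\<in>{g\<in>G. ?S - \<delta> n \<le> p g}. deriv_integral g v)"
      using \<delta>[of n] unfolding slope_sup_def by linarith
    ultimately have "\<exists>g\<in>{g\<in>G. ?S - \<delta> n \<le> p g}. slope_sup p v (\<delta> n) - \<delta> n < deriv_integral g v" .
    then show ?thesis by auto
  qed
  then have "\<forall>n. \<exists>g. g \<in> G \<and> ?S - \<delta> n \<le> p g \<and> slope_sup p v (\<delta> n) - \<delta> n < deriv_integral g v" ..
  from choice[OF this] obtain gs where
    "\<forall>n. gs n \<in> G \<and> ?S - \<delta> n \<le> p (gs n) \<and> slope_sup p v (\<delta> n) - \<delta> n < deriv_integral (gs n) v" ..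
  then have gs: "\<And>n. gs n \<in> G" "\<And>n. ?S - \<delta> n \<le> p (gs n)"
      "\<And>n. slope_sup p v (\<delta> n) - \<delta> n < deriv_integral (gs n) v"
    by simp_all
  obtain g r where g: "g \<in> G" and r: "strict_mono (r :: nat \<Rightarrow> nat)"
    and lim: "limitin uniform_topology (gs \<circ> r) g sequentially"
      "\<forall>t\<in>{0..1}. (\<lambda>n. gs (r n) t) \<longlonglongrightarrow> g t"
    by (rule compactin_uniform_subsequence[where gs = gs, OF compact gs(1)])
  have \<delta>r: "(\<lambda>n. \<delta> (r n)) \<longlonglongrightarrow> 0" using LIMSEQ_subseq_LIMSEQ[OF \<delta>0 r] by (simp add: o_def)
  have "limitin (subtopology uniform_topology G) (gs \<circ> r) g sequentially"
    using lim(1) g gs(1) by (simp add: limitin_subtopology)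
  from continuous_map_limit[OF cont this] have "(\<lambda>n. ereal (p (gs (r n)))) \<longlonglongrightarrow> ereal (p g)"
    using g gs(1) by (simp add: o_def f)
  then have "(\<lambda>n. p (gs (r n))) \<longlonglongrightarrow> p g" by simp
  moreover have "(\<lambda>n. ?S - \<delta> (r n)) \<longlonglongrightarrow> ?S - 0" by (intro tendsto_diff tendsto_const \<delta>r)
  ultimately have "?S - 0 \<le> p g" using gs(2) by (intro LIMSEQ_le) auto
  moreover have "p g \<le> ?S" by (rule cSUP_upper[OF g p])
  ultimately have "p g = ?S" by simp
  moreover have "sup_derivative p v \<le> deriv_integral g v"
  proof (rule LIMSEQ_le)
    have "filterlim (\<lambda>n. \<delta> (r n)) (at_right 0) sequentially"
      using \<delta>r \<delta> by (intro filterlim_at_withinI always_eventually) (auto simp: less_imp_neq[OF \<delta>, THEN not_sym])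
    from filterlim_compose[OF slope_sup_tendsto[OF p v] this]
    have "(\<lambda>n. slope_sup p v (\<delta> (r n)) - \<delta> (r n)) \<longlonglongrightarrow> sup_derivative p v - 0"
      by (rule tendsto_diff[OF _ \<delta>r])
    then show "(\<lambda>n. slope_sup p v (\<delta> (r n)) - \<delta> (r n)) \<longlonglongrightarrow> sup_derivative p v" by simp
    show "(\<lambda>n. deriv_integral (gs (r n)) v) \<longlonglongrightarrow> deriv_integral g v"
      by (rule deriv_integral_tendsto[OF gs(1) g lim(2)[rule_format] v])
    show "\<exists>N. \<forall>n\<ge>N. slope_sup p v (\<delta> (r n)) - \<delta> (r n) \<le> deriv_integral (gs (r n)) v"
      using gs(3) by (auto intro: less_imp_le)
  qed
  ultimately show thesis using g that by blast
qed

text \<open>Danskin's argument fed with the uniform expansion; \<open>diff\<close> says that base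
  and perturbed risks differ only by an integral over the interval.\<close>

lemma sup_difference_quotient:
  fixes p :: "(real \<Rightarrow> real) \<Rightarrow> real" and ps :: "nat \<Rightarrow> (real \<Rightarrow> real) \<Rightarrow> real"
  assumes p: "bdd_above (p ` G)" and ps: "\<And>n. bdd_above (ps n ` G)"
    and diff: "\<And>n g. g \<in> G \<Longrightarrow>
      ps n g - p g = (\<integral>x. indicator (einterval a b) x * (g (Fs n x) - g (F0 x)) \<partial>lborel)"
    and Fs: "\<And>n. mono (Fs n)" "\<And>n x. 0 \<le> Fs n x \<and> Fs n x \<le> 1"
    and eq: "\<And>n x. Fs n x = F0 x + h n * vs n x"
    and h: "\<And>n. 0 < h n" "h \<longlonglongrightarrow> 0"
    and vs: "\<And>n x. \<bar>vs n x * \<phi> x\<bar> \<le> C" "\<And>x. (\<lambda>n. vs n x) \<longlonglongrightarrow> v x"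
    and v: "v \<in> borel_measurable borel" "\<And>x. \<bar>v x * \<phi> x\<bar> \<le> D"
  shows "(\<lambda>n. ((SUP g\<in>G. ps n g) - (SUP g\<in>G. p g)) / h n) \<longlonglongrightarrow> sup_derivative p v"
proof (rule Danskin_sequence[OF G_nonempty p ps deriv_integral_bound[OF _ v] h])
  show "\<forall>\<^sub>F n in sequentially. \<forall>g\<in>G. \<bar>ps n g - p g - h n * deriv_integral g v\<bar> \<le> e * h n"
    if "0 < e" for e
    using uniform_expansion[OF Fs eq h vs v that] by (simp add: diff)
  show "((\<lambda>\<epsilon>. SUP g\<in>{g\<in>G. (SUP g\<in>G. p g) - \<epsilon> \<le> p g}. deriv_integral g v)
      \<longlongrightarrow> sup_derivative p v) (at_right 0)"
    using slope_sup_tendsto[OF p v] unfolding slope_sup_def[abs_def] .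
qed

end

section \<open>Quasi-Hadamard differentiability\<close>

lemma ereal_SUP_bdd:
  fixes f :: "'a \<Rightarrow> real"
  assumes "A \<noteq> {}" "bdd_above (f ` A)"
  shows "ereal (SUP a\<in>A. f a) = (SUP a\<in>A. ereal (f a))"
proof (rule ereal_SUP)
  from assms(1) obtain x where x: "x \<in> A" by auto
  from assms(2) obtain B where B: "\<And>a. a \<in> A \<Longrightarrow> f a \<le> B" by (auto simp: bdd_above_def)
  have "(SUP a\<in>A. ereal (f a)) \<le> ereal B" using B by (intro SUP_least) simp
  moreover have "ereal (f x) \<le> (SUP a\<in>A. ereal (f a))" using x by (rule SUP_upper)
  ultimately show "\<bar>SUP a\<in>A. ereal (f a)\<bar> \<noteq> \<infinity>"
    by (cases "SUP a\<in>A. ereal (f a)") auto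
qed

text \<open>The supremum over the empty set is minus infinity, so a finite value forces
  \<open>A \<noteq> {}\<close>; non-emptiness of \<open>G\<close> is obtained this way.\<close>

lemma bdd_above_ereal_SUP:
  fixes f :: "'a \<Rightarrow> real"
  assumes "ereal c = (SUP a\<in>A. ereal (f a))"
  shows "A \<noteq> {}" "bdd_above (f ` A)" "c = (SUP a\<in>A. f a)"
proof -
  show ne: "A \<noteq> {}" using assms by (auto simp: bot_ereal_def)
  have "ereal (f a) \<le> ereal c" if "a \<in> A" for a
    unfolding assms using that by (rule SUP_upper)
  then show bdd: "bdd_above (f ` A)" by (intro bdd_aboveI2[of A f c]) simp
  from assms ereal_SUP_bdd[OF ne bdd] have "ereal c = ereal (SUP a\<in>A. f a)"
    by (rule trans[OF _ sym])
  then show "c = (SUP a\<in>A. f a)" by (simp only: ereal.inject)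
qed

lemma F_inside_quantiles:
  assumes "mono F" "x \<in> einterval (right_quantile F 0) (left_quantile F 1)"
  shows "0 < F x \<and> F x < 1"
proof
  have x: "right_quantile F 0 < ereal x" "ereal x < left_quantile F 1"
    using assms(2) by (auto simp: einterval_iff)
  from x(1) obtain y where "F y > 0" "y < x"
    unfolding right_quantile_def Inf_less_iff by auto
  then show "0 < F x" using monoD[OF assms(1), of y x] by simp
  show "F x < 1"
  proof (rule ccontr)
    assume "\<not> F x < 1"
    then have "left_quantile F 1 \<le> ereal x"
      unfolding left_quantile_def by (intro Inf_lower) auto
    with x(2) show False by simp
  qed
qed

lemma right_quantile_0_le_left_quantile_1: "right_quantile F 0 \<le> left_quantile F 1"
  unfolding left_quantile_def right_quantile_def by (rule Inf_superset_mono) force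

text \<open>Equal values at \<open>x < y\<close> make the monotone \<open>F\<close> constant in
  between, so its derivative vanishes at some point there outside the finite set
  \<open>D\<close>.\<close>

lemma inj_on_positive_deriv:
  fixes F :: "real \<Rightarrow> real"
  assumes F: "mono F" and D: "finite D" and pos: "\<And>x. x \<in> einterval a b - D \<Longrightarrow> deriv F x > 0"
  shows "inj_on F (einterval a b)"
proof (rule linorder_inj_onI)
  fix x y assume xy: "x < y" "x \<in> einterval a b" "y \<in> einterval a b"
  show "F x \<noteq> F y"
  proof
    assume eq: "F x = F y"
    have "infinite ({x<..<y} - D)" using xy(1) D by (simp add: infinite_Ioo)
    then obtain z where z: "x < z" "z < y" "z \<notin> D"
      by (metis DiffE greaterThanLessThan_iff finite.emptyI all_not_in_conv)
    have const: "F u = F x" if "u \<in> {x<..<y}" for u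
      using monoD[OF F, of x u] monoD[OF F, of u y] that eq by simp
    have "((\<lambda>_. F x) has_real_derivative 0) (at z)" by simp
    then have "(F has_real_derivative 0) (at z)"
      by (rule has_field_derivative_transform_within_open[of _ _ _ "{x<..<y}"]) (use z const in auto)
    then have "deriv F z = 0" by (rule DERIV_imp_deriv)
    moreover have "z \<in> einterval a b - D"
      using xy z by (auto simp: einterval_iff intro: less_trans[of a "ereal x" "ereal z"] less_trans[of "ereal z" "ereal y" b])
    ultimately show False using pos by fastforce
  qed
qed auto

text \<open>Each single risk lies below the supremum \<open>\<rho> X\<close>, which is real; this
  supplies the finiteness required for the integral form.\<close>

lemma dfs_distortion_risk:
  assumes M: "prob_space M" and XX: "risk_space M XX" and rep: "representing_set M XX \<rho> G"
    and F: "F \<in> dfs M XX"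
  shows "mono F" "\<And>x. 0 \<le> F x \<and> F x \<le> 1"
    and "\<And>g. g \<in> G \<Longrightarrow> integrable lborel (\<lambda>x. g (F x) - indicator {0..} x)"
    and "\<And>g. g \<in> G \<Longrightarrow> distortion_risk g F = ereal (\<integral>x. g (F x) - indicator {0..} x \<partial>lborel)"
    and "ereal (risk_functional M XX \<rho> F)
      = (SUP g\<in>G. ereal (\<integral>x. g (F x) - indicator {0..} x \<partial>lborel))"
proof -
  interpret prob_space M by fact
  obtain X where X: "X \<in> XX" "F = df M X" using F by (auto simp: dfs_def)
  have int: "integrable M X" using XX X(1) by (auto simp: risk_space_def)
  then have "X \<in> borel_measurable M" by simp
  then interpret D: real_distribution "distr M borel X" by (rule real_distribution_distr)
  have Fcdf: "F = cdf (distr M borel X)" using X(2) by (simp add: df_def)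
  show mono: "mono F" unfolding Fcdf by (intro monoI D.cdf_nondecreasing)
  show range: "0 \<le> F x \<and> F x \<le> 1" for x
    unfolding Fcdf using D.cdf_nonneg D.cdf_bounded_prob by simp
  have tail: "(\<integral>\<^sup>+x\<in>{0..}. ennreal (1 - F x) \<partial>lborel) < \<infinity>"
    unfolding Fcdf by (rule nn_integral_tail_finite[OF int])
  have \<rho>: "ereal (\<rho> Y) = (SUP g\<in>G. distortion_risk g (df M Y))" if "Y \<in> XX" for Y
    using rep that by (simp add: representing_set_def)
  have fin: "distortion_risk g F \<noteq> \<infinity>" if "g \<in> G" for g
  proof -
    have "distortion_risk g F \<le> ereal (\<rho> X)"
      unfolding \<rho>[OF X(1)] X(2) by (rule SUP_upper[OF that])
    then show ?thesis by auto
  qed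
  have conc: "concave_on {0..1} g" and dist: "distortion_function g" if "g \<in> G" for g
    using rep that by (simp_all add: representing_set_def)
  show "integrable lborel (\<lambda>x. g (F x) - indicator {0..} x)"
    and risk: "distortion_risk g F = ereal (\<integral>x. g (F x) - indicator {0..} x \<partial>lborel)" if "g \<in> G" for g
    using distortion_risk_eq_integral[OF dist[OF that] concave_distortion_ge[OF conc[OF that] dist[OF that]]
      mono range tail fin[OF that]] by simp_all
  \<comment> \<open>The description is unique because the representation expresses
    \<open>\<rho> Y\<close> through \<open>df M Y\<close> alone.\<close>
  have "risk_functional M XX \<rho> F = \<rho> X"
    unfolding risk_functional_def
  proof (rule the_equality)
    show "\<exists>Y\<in>XX. df M Y = F \<and> \<rho> X = \<rho> Y" using X by auto
  next
    fix r assume "\<exists>Y\<in>XX. df M Y = F \<and> r = \<rho> Y"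
    then obtain Y where Y: "Y \<in> XX" "df M Y = F" "r = \<rho> Y" by auto
    have "ereal (\<rho> Y) = ereal (\<rho> X)" unfolding \<rho>[OF Y(1)] \<rho>[OF X(1)] Y(2) X(2) ..
    then show "r = \<rho> X" using Y(3) by simp
  qed
  then have "ereal (risk_functional M XX \<rho> F) = (SUP g\<in>G. distortion_risk g F)"
    using \<rho>[OF X(1)] X(2) by simp
  also have "\<dots> = (SUP g\<in>G. ereal (\<integral>x. g (F x) - indicator {0..} x \<partial>lborel))"
    by (rule SUP_cong[OF refl]) (rule risk)
  finally show "ereal (risk_functional M XX \<rho> F)
      = (SUP g\<in>G. ereal (\<integral>x. g (F x) - indicator {0..} x \<partial>lborel))" .
qed

section \<open>Functions in the weighted spaces\<close>

lemma D_weighted_measurable: "v \<in> D_weighted \<phi> \<Longrightarrow> v \<in> borel_measurable borel"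
  by (simp add: D_weighted_def cadlag_borel_measurable)

lemma D_weighted_bound:
  assumes "v \<in> D_weighted \<phi>"
  shows "\<bar>v x * \<phi> x\<bar> \<le> weighted_norm \<phi> v"
  unfolding weighted_norm_def by (rule cSUP_upper) (use assms in \<open>auto simp: D_weighted_def\<close>)

text \<open>A real supremum bounds its terms only if the range is bounded above; the triangle
  inequality supplies that.\<close>

lemma D_weighted_diff_bound:
  assumes "v \<in> D_weighted \<phi>" "u \<in> D_weighted \<phi>"
  shows "\<bar>(v x - u x) * \<phi> x\<bar> \<le> weighted_norm \<phi> (\<lambda>x. v x - u x)"
  unfolding weighted_norm_def
proof (rule cSUP_upper)
  show "bdd_above (range (\<lambda>x. \<bar>(v x - u x) * \<phi> x\<bar>))"
  proof (rule bdd_aboveI2)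
    fix x
    have "\<bar>(v x - u x) * \<phi> x\<bar> \<le> \<bar>v x * \<phi> x\<bar> + \<bar>u x * \<phi> x\<bar>"
      by (simp add: left_diff_distrib abs_triangle_ineq4)
    also have "\<dots> \<le> weighted_norm \<phi> v + weighted_norm \<phi> u"
      by (intro add_mono D_weighted_bound assms)
    finally show "\<bar>(v x - u x) * \<phi> x\<bar> \<le> weighted_norm \<phi> v + weighted_norm \<phi> u" .
  qed
qed simp

text \<open>Scaling by \<open>\<gamma>\<close> bounds \<open>g (F0 x) / F0 x\<close> by
  \<open>g (\<gamma> * F0 x) / (\<gamma> * F0 x)\<close>, and the associated distortion dominates
  every \<open>g\<close>. The resulting weight is \<open>1 / \<gamma>\<close> times the integrand of
  (b).\<close>

lemma distortion_family_quantiles: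
  fixes G :: "(real \<Rightarrow> real) set" and F0 \<phi> :: "real \<Rightarrow> real"
  defines "a \<equiv> right_quantile F0 0" and "b \<equiv> left_quantile F0 1"
  assumes rep: "representing_set M XX \<rho> G" and ne: "G \<noteq> {}"
    and F0: "mono F0" "\<And>x. 0 \<le> F0 x \<and> F0 x \<le> 1" and \<phi>: "weight_function \<phi>"
    and D: "finite D" "\<And>x. x \<in> einterval a b - D \<Longrightarrow> deriv F0 x > 0"
    and \<gamma>: "0 < \<gamma>" "\<gamma> < 1"
    and int: "(\<integral>\<^sup>+x\<in>einterval a b.
              ennreal (assoc_distortion M \<rho> (\<gamma> * F0 x) / (F0 x * \<phi> x)) \<partial>lborel) < \<infinity>"
  shows "distortion_family G F0 \<phi> (\<lambda>x. assoc_distortion M \<rho> (\<gamma> * F0 x) / (\<gamma> * F0 x * \<phi> x)) a b"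
proof
  let ?A = "assoc_distortion M \<rho>"
  show conc: "concave_on {0..1} g" and dist: "distortion_function g" if "g \<in> G" for g
    using rep that by (simp_all add: representing_set_def)
  show "compactin uniform_topology G" using rep by (simp add: representing_set_def)
  have inside: "0 < F0 x \<and> F0 x < 1" if "x \<in> einterval a b" for x
    using F_inside_quantiles[OF F0(1)] that unfolding a_def b_def .
  then show "x \<in> einterval a b \<Longrightarrow> 0 < F0 x \<and> F0 x < 1" for x .
  show "inj_on F0 (einterval a b)" by (rule inj_on_positive_deriv[OF F0(1) D])
  show \<phi>1: "1 \<le> \<phi> x" for x using \<phi> by (simp add: weight_function_def)
  have A: "?A t = (SUP g\<in>G. g t)" if "0 \<le> t" "t \<le> 1" for t
    using rep that by (simp add: representing_set_def)
  have g01: "0 \<le> g t \<and> g t \<le> 1" if "g \<in> G" "0 \<le> t" "t \<le> 1" for g t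
    using dist[OF that(1)] that(2,3) by (auto simp: distortion_function_def Pi_iff)
  have le_A: "g t \<le> ?A t" if "g \<in> G" "0 \<le> t" "t \<le> 1" for g t
    unfolding A[OF that(2,3)]
    by (rule cSUP_upper[OF that(1)]) (use g01[OF _ that(2,3)] in \<open>auto intro!: bdd_aboveI2[where M = 1]\<close>)
  have \<gamma>F: "0 \<le> \<gamma> * F0 x" "\<gamma> * F0 x \<le> 1" for x
    using F0(2)[of x] \<gamma> mult_le_one[of \<gamma> "F0 x"] by auto
  have A_nonneg: "0 \<le> ?A (\<gamma> * F0 x)" for x
    using ne g01[OF _ \<gamma>F] le_A[OF _ \<gamma>F] by (meson all_not_in_conv order_trans)
  \<comment> \<open>Monotonicity of a supremum of monotone functions gives measurability, although
    \<open>G\<close> may be uncountable.\<close>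
  have "mono (\<lambda>x. ?A (\<gamma> * F0 x))"
  proof (rule monoI)
    fix x y :: real assume "x \<le> y"
    then have F0xy: "\<gamma> * F0 x \<le> \<gamma> * F0 y" using monoD[OF F0(1)] \<gamma> by simp
    show "?A (\<gamma> * F0 x) \<le> ?A (\<gamma> * F0 y)"
      unfolding A[OF \<gamma>F, of x]
    proof (rule cSUP_least[OF ne])
      fix g assume g: "g \<in> G"
      have "g (\<gamma> * F0 x) \<le> g (\<gamma> * F0 y)"
        using dist[OF g] F0xy \<gamma>F by (auto simp: distortion_function_def mono_on_def)
      also have "\<dots> \<le> ?A (\<gamma> * F0 y)" by (rule le_A[OF g \<gamma>F])
      finally show "g (\<gamma> * F0 x) \<le> ?A (\<gamma> * F0 y)" .
    qed
  qed
  then have [measurable]: "(\<lambda>x. ?A (\<gamma> * F0 x)) \<in> borel_measurable borel" by (rule borel_measurable_mono)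
  have [measurable]: "F0 \<in> borel_measurable borel" by (rule borel_measurable_mono[OF F0(1)])
  have [measurable]: "\<phi> \<in> borel_measurable borel"
    using \<phi> by (simp add: weight_function_def borel_measurable_continuous_onI)
  let ?u = "\<lambda>x. indicator (einterval a b) x * (?A (\<gamma> * F0 x) / (F0 x * \<phi> x))"
  have "integrable lborel ?u"
  proof (rule integrableI_nonneg)
    show "?u \<in> borel_measurable lborel" by measurable
    have "0 \<le> ?u x" for x
      using A_nonneg[of x] F0(2)[of x] \<phi>1[of x] by simp
    then show "AE x in lborel. 0 \<le> ?u x" by simp
    have "(\<integral>\<^sup>+x. ennreal (?u x) \<partial>lborel)
        = (\<integral>\<^sup>+x\<in>einterval a b. ennreal (?A (\<gamma> * F0 x) / (F0 x * \<phi> x)) \<partial>lborel)"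
      by (rule nn_integral_cong) (simp add: indicator_def)
    with int show "(\<integral>\<^sup>+x. ennreal (?u x) \<partial>lborel) < \<infinity>" by simp
  qed
  then have "integrable lborel (\<lambda>x. (1 / \<gamma>) * ?u x)" by (rule integrable_mult_right)
  then show "integrable lborel (\<lambda>x. indicator (einterval a b) x * (?A (\<gamma> * F0 x) / (\<gamma> * F0 x * \<phi> x)))"
    by (simp add: mult.assoc mult.left_commute)
  show "g (F0 x) / F0 x \<le> ?A (\<gamma> * F0 x) / (\<gamma> * F0 x * \<phi> x) * \<phi> x"
    if g: "g \<in> G" and x: "x \<in> einterval a b" for g x
  proof -
    have F: "0 < F0 x" "F0 x \<le> 1" using inside[OF x] by auto
    have "g (F0 x) \<le> g (\<gamma> * F0 x) / \<gamma>"
      by (rule concave_distortion_scale[OF conc[OF g] dist[OF g] F \<gamma>])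
    also have "\<dots> \<le> ?A (\<gamma> * F0 x) / \<gamma>" using le_A[OF g \<gamma>F] \<gamma> by (simp add: divide_right_mono)
    finally have "g (F0 x) / F0 x \<le> ?A (\<gamma> * F0 x) / \<gamma> / F0 x"
      using F by (intro divide_right_mono) auto
    also have "\<dots> = ?A (\<gamma> * F0 x) / (\<gamma> * F0 x * \<phi> x) * \<phi> x" using \<phi>1[of x] by simp
    finally show ?thesis .
  qed
qed (use ne F0 in auto)

text \<open>An interval integral changes sign when its end points are reversed; the order of the two
  quantiles excludes this.\<close>

lemma distortion_derivative_eq:
  "distortion_derivative g F0 v =
    (\<integral>x. indicator (einterval (right_quantile F0 0) (left_quantile F0 1)) x
      * (right_deriv g (F0 x) * v x) \<partial>lborel)"
  by (simp add: distortion_derivative_def interval_lebesgue_integral_def set_lebesgue_integral_def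
      right_quantile_0_le_left_quantile_1)

lemma integral_perturbation_eq:
  fixes F F0 :: "real \<Rightarrow> real"
  defines "I \<equiv> einterval (right_quantile F0 0) (left_quantile F0 1)"
  assumes int: "integrable lborel (\<lambda>x. g (F x) - indicator {0..} x :: real)"
      "integrable lborel (\<lambda>x. g (F0 x) - indicator {0..} x :: real)"
    and v: "v \<in> D_supported \<phi> F0" and F: "\<And>x. F x = F0 x + h * v x"
    and meas: "(\<lambda>x. g (F x)) \<in> borel_measurable borel" "(\<lambda>x. g (F0 x)) \<in> borel_measurable borel"
  shows "(\<integral>x. g (F x) - indicator {0..} x \<partial>lborel) - (\<integral>x. g (F0 x) - indicator {0..} x \<partial>lborel)
    = (\<integral>x. indicator I x * (g (F x) - g (F0 x)) \<partial>lborel)"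
proof -
  have "(\<integral>x. g (F x) - indicator {0..} x \<partial>lborel) - (\<integral>x. g (F0 x) - indicator {0..} x \<partial>lborel)
      = (\<integral>x. g (F x) - g (F0 x) \<partial>lborel)"
    by (subst Bochner_Integration.integral_diff[OF int, symmetric]) simp
  also have "\<dots> = (\<integral>x. indicator I x * (g (F x) - g (F0 x)) \<partial>lborel)"
  proof (rule integral_cong_AE)
    \<comment> \<open>\<open>v\<close> vanishes outside the closed interval, \<open>I\<close> is
      open, and the end points are null. For an infinite end point \<open>real_of_ereal\<close> is
      \<open>0\<close>, which merely removes one more point.\<close>
    show "AE x in lborel. g (F x) - g (F0 x) = indicator I x * (g (F x) - g (F0 x))"
      using AE_lborel_singleton[of "real_of_ereal (right_quantile F0 0)"]
        AE_lborel_singleton[of "real_of_ereal (left_quantile F0 1)"]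
    proof eventually_elim
      case (elim x)
      show ?case
      proof (cases "x \<in> I")
        case False
        have "ereal x \<noteq> right_quantile F0 0" "ereal x \<noteq> left_quantile F0 1"
          using elim by (metis real_of_ereal.simps(1))+
        with False have "\<not> (right_quantile F0 0 \<le> ereal x \<and> ereal x \<le> left_quantile F0 1)"
          unfolding I_def einterval_iff by (auto simp: less_le)
        with v have "v x = 0" by (simp add: D_supported_def)
        then show ?thesis by (simp add: F)
      qed simp
    qed
  qed (use meas in \<open>simp_all add: I_def\<close>)
  finally show ?thesis .
qed

theorem theorem2p4:
  fixes M :: "'a measure" and XX :: "('a \<Rightarrow> real) set" and \<rho> :: "('a \<Rightarrow> real) \<Rightarrow> real"
    and G :: "(real \<Rightarrow> real) set" and F0 \<phi> :: "real \<Rightarrow> real"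
  assumes "prob_space M" and "atomless M"
    and "risk_space M XX" and "stonean XX"
    and "coherent_risk_measure M XX \<rho>" and "law_invariant M XX \<rho>"
    and "\<And>X. X \<in> XX \<Longrightarrow> (AE \<omega> in M. 0 \<le> X \<omega>) \<Longrightarrow>
           (\<lambda>k::nat. \<rho> (\<lambda>\<omega>. - max (X \<omega> - real k) 0)) \<longlonglongrightarrow> 0"
    and "(assoc_distortion M \<rho> \<longlongrightarrow> 0) (at_right 0)"
    and "F0 \<in> dfs M XX" and "weight_function \<phi>"
    and "\<exists>D. finite D \<and>
           (\<forall>x\<in>einterval (right_quantile F0 0) (left_quantile F0 1) - D.
              F0 differentiable at x \<and> deriv F0 x > 0) \<and>
           continuous_on (einterval (right_quantile F0 0) (left_quantile F0 1) - D) (deriv F0)"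
    and "\<exists>\<gamma>\<in>{0<..<1}.
           (\<integral>\<^sup>+x\<in>einterval (right_quantile F0 0) (left_quantile F0 1).
              ennreal (assoc_distortion M \<rho> (\<gamma> * F0 x) / (F0 x * \<phi> x)) \<partial>lborel) < \<infinity>"
    and "representing_set M XX \<rho> G"
  shows "\<exists>R'.
     has_quasi_Hadamard_derivative (risk_functional M XX \<rho>) (dfs M XX) F0 \<phi> R' \<and>
     (\<forall>v\<in>C_tangent \<phi> F0.
        ((\<lambda>\<epsilon>. SUP g\<in>approx_maximizers G (risk_functional M XX \<rho>) F0 \<epsilon>.
            ereal (distortion_derivative g F0 v)) \<longlongrightarrow> ereal (R' v)) (at_right 0)) \<and>
     ((\<exists>\<delta>\<in>{0<..<1}.
         (\<integral>\<^sup>+x\<in>{..0}. ennreal (assoc_distortion M \<rho> (\<delta> * F0 x)) \<partial>lborel) < \<infinity>) \<longrightarrow>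
      maximizers G (risk_functional M XX \<rho>) F0 \<noteq> {} \<and>
      (\<forall>v\<in>C_tangent \<phi> F0.
         ereal (R' v) = (SUP g\<in>maximizers G (risk_functional M XX \<rho>) F0.
           ereal (distortion_derivative g F0 v))))"
proof -
  let ?R = "risk_functional M XX \<rho>" and ?a = "right_quantile F0 0" and ?b = "left_quantile F0 1"
  define p where "p F g = (\<integral>x. g (F x) - indicator {0..} x \<partial>lborel)" for F g :: "real \<Rightarrow> real"
  note risk = dfs_distortion_risk[OF assms(1,3,13)]
  have R: "ereal (?R F) = (SUP g\<in>G. ereal (p F g))" if "F \<in> dfs M XX" for F
    unfolding p_def by (rule risk(5)[OF that])
  note bdd = bdd_above_ereal_SUP(2)[OF R] and R_eq = bdd_above_ereal_SUP(3)[OF R]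
  note p0 = bdd[OF assms(9)] and R0 = R_eq[OF assms(9)]
  have p_eq: "distortion_risk g F0 = ereal (p F0 g)" if "g \<in> G" for g
    unfolding p_def by (rule risk(4)[OF assms(9) that])
  obtain D where D: "finite D" "\<And>x. x \<in> einterval ?a ?b - D \<Longrightarrow> deriv F0 x > 0"
    using assms(11) by blast
  obtain \<gamma> where \<gamma>: "\<gamma> \<in> {0<..<1}" and int: "(\<integral>\<^sup>+x\<in>einterval ?a ?b.
      ennreal (assoc_distortion M \<rho> (\<gamma> * F0 x) / (F0 x * \<phi> x)) \<partial>lborel) < \<infinity>"
    using assms(12) by blast
  interpret distortion_family G F0 \<phi> "\<lambda>x. assoc_distortion M \<rho> (\<gamma> * F0 x) / (\<gamma> * F0 x * \<phi> x)" ?a ?b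
    using \<gamma> by (intro distortion_family_quantiles[OF assms(13) bdd_above_ereal_SUP(1)[OF R[OF assms(9)]]
      risk(1,2)[OF assms(9)] assms(10) D _ _ int]) auto
  have deriv_eq: "distortion_derivative g F0 v = deriv_integral g v" for g v
    by (simp only: distortion_derivative_eq deriv_integral_def)
  have DW: "v \<in> D_weighted \<phi>" if "v \<in> C_tangent \<phi> F0 \<or> v \<in> D_supported \<phi> F0" for v
    using that by (auto simp: C_tangent_def D_supported_def)
  note meas = D_weighted_measurable[OF DW[OF disjI1]] and bound = D_weighted_bound[OF DW[OF disjI1]]
  have approx: "approx_maximizers G ?R F0 \<epsilon> = {g\<in>G. (SUP g\<in>G. p F0 g) - \<epsilon> \<le> p F0 g}" for \<epsilon>
    unfolding approx_maximizers_def R0 by (auto simp: p_eq)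
  have maxi: "maximizers G ?R F0 = {g\<in>G. p F0 g = (SUP g\<in>G. p F0 g)}"
    unfolding maximizers_def R0 by (auto simp: p_eq)

  let ?R' = "sup_derivative (p F0)"
  have lip: "\<bar>?R' w - ?R' v\<bar> \<le> weighted_norm \<phi> (\<lambda>x. w x - v x) * weight_mass"
    if v: "v \<in> C_tangent \<phi> F0" and w: "w \<in> C_tangent \<phi> F0" for v w
  proof -
    have d: "\<bar>(w x - v x) * \<phi> x\<bar> \<le> weighted_norm \<phi> (\<lambda>x. w x - v x)" for x
      by (rule D_weighted_diff_bound[OF DW[OF disjI1[OF w]] DW[OF disjI1[OF v]]])
    then have d': "\<bar>(v x - w x) * \<phi> x\<bar> \<le> weighted_norm \<phi> (\<lambda>x. w x - v x)" for x
      by (simp add: abs_mult abs_minus_commute)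
    from sup_derivative_lipschitz[OF p0 meas[OF w] bound[OF w] meas[OF v] bound[OF v] d]
      sup_derivative_lipschitz[OF p0 meas[OF v] bound[OF v] meas[OF w] bound[OF w] d']
    show ?thesis by (simp add: abs_le_iff)
  qed
  have "has_quasi_Hadamard_derivative ?R (dfs M XX) F0 \<phi> ?R'"
    unfolding has_quasi_Hadamard_derivative_def
  proof (intro conjI ballI allI impI; (elim conjE)?)
    fix v and e :: real assume v: "v \<in> C_tangent \<phi> F0" and e: "0 < e"
    show "\<exists>d>0. \<forall>w\<in>C_tangent \<phi> F0. weighted_norm \<phi> (\<lambda>x. w x - v x) < d \<longrightarrow> \<bar>?R' w - ?R' v\<bar> < e"
    \<comment> \<open>The summand \<open>1\<close> covers the case
      \<open>weight_mass = 0\<close>.\<close>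
    proof (intro exI[of _ "e / (weight_mass + 1)"] conjI ballI impI)
      show "0 < e / (weight_mass + 1)" using e weight_mass_nonneg by simp
      fix w assume w: "w \<in> C_tangent \<phi> F0" and small: "weighted_norm \<phi> (\<lambda>x. w x - v x) < e / (weight_mass + 1)"
      have "\<bar>?R' w - ?R' v\<bar> \<le> e / (weight_mass + 1) * weight_mass"
        by (rule order_trans[OF lip[OF v w] mult_right_mono[OF less_imp_le[OF small] weight_mass_nonneg]])
      also have "\<dots> < e" using e weight_mass_nonneg by (simp add: field_simps)
      finally show "\<bar>?R' w - ?R' v\<bar> < e" .
    qed
  next
    fix v vs and h :: "nat \<Rightarrow> real"
    assume v: "v \<in> C_tangent \<phi> F0" and vs: "\<forall>n. vs n \<in> D_supported \<phi> F0"
      and lim: "(\<lambda>n. weighted_norm \<phi> (\<lambda>x. vs n x - v x)) \<longlonglongrightarrow> 0"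
      and Fs: "\<forall>n. (\<lambda>x. F0 x + h n * vs n x) \<in> dfs M XX" and h: "\<forall>n. 0 < h n" "h \<longlonglongrightarrow> 0"
    note Fs' = Fs[rule_format] and vs' = vs[rule_format]
    have d: "\<bar>(vs n x - v x) * \<phi> x\<bar> \<le> weighted_norm \<phi> (\<lambda>x. vs n x - v x)" for n x
      by (rule D_weighted_diff_bound[OF DW[OF disjI2[OF vs']] DW[OF disjI1[OF v]]])
    \<comment> \<open>Convergent norms are bounded, which yields one constant for all
      \<open>vs n\<close> and hence one majorant.\<close>
    from convergent_imp_Bseq[OF convergentI[OF lim]] obtain K
      where K: "\<And>n. \<bar>weighted_norm \<phi> (\<lambda>x. vs n x - v x)\<bar> \<le> K"
      by (auto simp: Bseq_def)
    have vs_bound: "\<bar>vs n x * \<phi> x\<bar> \<le> weighted_norm \<phi> v + K" for n x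
    proof -
      have "vs n x * \<phi> x = v x * \<phi> x + (vs n x - v x) * \<phi> x" by (simp add: algebra_simps)
      then show ?thesis using bound[OF v, of x] d[of n x] K[of n] by linarith
    qed
    have vs_lim: "(\<lambda>n. vs n x) \<longlonglongrightarrow> v x" for x
    proof (rule LIM_zero_cancel, rule tendsto_0_le[OF lim, of _ 1], rule always_eventually, rule allI)
      fix n
      have "\<bar>vs n x - v x\<bar> * 1 \<le> \<bar>vs n x - v x\<bar> * \<phi> x"
        using \<phi>_ge_1 by (intro mult_left_mono) auto
      also have "\<dots> = \<bar>(vs n x - v x) * \<phi> x\<bar>" using \<phi>_ge_1[of x] by (simp add: abs_mult)
      also have "\<dots> \<le> \<bar>weighted_norm \<phi> (\<lambda>x. vs n x - v x)\<bar>" by (rule order_trans[OF d abs_ge_self])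
      finally show "norm (vs n x - v x) \<le> norm (weighted_norm \<phi> (\<lambda>x. vs n x - v x)) * 1" by simp
    qed
    have "(\<lambda>n. ((SUP g\<in>G. p (\<lambda>x. F0 x + h n * vs n x) g) - (SUP g\<in>G. p F0 g)) / h n) \<longlonglongrightarrow> ?R' v"
    proof (rule sup_difference_quotient[OF p0 bdd[OF Fs'] _ risk(1)[OF Fs'] risk(2)[OF Fs'] refl
        h(1)[rule_format] h(2) vs_bound vs_lim meas[OF v] bound[OF v]])
      fix n g assume g: "g \<in> G"
      show "p (\<lambda>x. F0 x + h n * vs n x) g - p F0 g = (\<integral>x. indicator (einterval ?a ?b) x *
          (g (F0 x + h n * vs n x) - g (F0 x)) \<partial>lborel)"
        unfolding p_def
        by (rule integral_perturbation_eq[OF risk(3)[OF Fs' g] risk(3)[OF assms(9) g] vs' refl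
            composed_measurable[OF g risk(1,2)[OF Fs']] composed_measurable[OF g F0_mono F0_range]])
    qed
    then have "(\<lambda>n. (?R (\<lambda>x. F0 x + h n * vs n x) - ?R F0) / h n) \<longlonglongrightarrow> ?R' v"
      by (simp only: R_eq[OF Fs'] R0)
    then show "(\<lambda>n. \<bar>(?R (\<lambda>x. F0 x + h n * vs n x) - ?R F0) / h n - ?R' v\<bar>) \<longlonglongrightarrow> 0"
      by (intro tendsto_rabs_zero) (simp add: LIM_zero)
  qed
  moreover have "((\<lambda>\<epsilon>. SUP g\<in>approx_maximizers G ?R F0 \<epsilon>. ereal (distortion_derivative g F0 v))
      \<longlongrightarrow> ereal (?R' v)) (at_right 0)" if v: "v \<in> C_tangent \<phi> F0" for v
  proof (rule Lim_transform_eventually)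
    show "((\<lambda>\<epsilon>. ereal (slope_sup (p F0) v \<epsilon>)) \<longlongrightarrow> ereal (?R' v)) (at_right 0)"
      using slope_sup_tendsto[OF p0 meas[OF v] bound[OF v]] by simp
    \<comment> \<open>For positive \<open>\<epsilon>\<close> the almost maximizers form a nonempty
      set with bounded slopes, so real and extended suprema agree.\<close>
    have "ereal (slope_sup (p F0) v \<epsilon>)
        = (SUP g\<in>approx_maximizers G ?R F0 \<epsilon>. ereal (distortion_derivative g F0 v))" if "0 < \<epsilon>" for \<epsilon>
      unfolding slope_sup_def approx deriv_eq
      by (rule ereal_SUP_bdd[OF almost_maximizers_nonempty[OF p0 that]
            bdd_above_deriv_integral[OF meas[OF v] bound[OF v]]]) auto
    then show "\<forall>\<^sub>F \<epsilon> in at_right 0. ereal (slope_sup (p F0) v \<epsilon>)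
        = (SUP g\<in>approx_maximizers G ?R F0 \<epsilon>. ereal (distortion_derivative g F0 v))"
      by (intro eventually_at_rightI[of 0 1]) auto
  qed
  moreover have "maximizers G ?R F0 \<noteq> {} \<and> (\<forall>v\<in>C_tangent \<phi> F0. ereal (?R' v)
      = (SUP g\<in>maximizers G ?R F0. ereal (distortion_derivative g F0 v)))"
    if fin: "\<exists>\<delta>\<in>{0<..<1}. (\<integral>\<^sup>+x\<in>{..0}. ennreal (assoc_distortion M \<rho> (\<delta> * F0 x)) \<partial>lborel) < \<infinity>"
  proof -
    obtain X where X: "X \<in> XX" "F0 = df M X" using assms(9) by (auto simp: dfs_def)
    have "continuous_map (subtopology uniform_topology G) euclidean (\<lambda>g. distortion_risk g F0)"
      using assms(13) X(1) fin unfolding representing_set_def X(2) by simp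
    note attain = maximizer_attaining_sup_derivative[OF p0 meas bound this p_eq]
    have ex: "\<exists>g\<in>maximizers G ?R F0. ?R' v \<le> deriv_integral g v" if v: "v \<in> C_tangent \<phi> F0" for v
      by (rule attain[OF v v]) (auto simp: maxi)
    \<comment> \<open>Maximizers do not depend on the direction, so the zero direction suffices to
      produce one.\<close>
    have "(\<lambda>_. 0) \<in> C_tangent \<phi> F0"
      by (auto simp: C_tangent_def D_supported_def D_weighted_def cadlag_def)
    from ex[OF this] have "maximizers G ?R F0 \<noteq> {}" by auto
    moreover have "ereal (?R' v) = (SUP g\<in>maximizers G ?R F0. ereal (distortion_derivative g F0 v))"
      if v: "v \<in> C_tangent \<phi> F0" for v
    proof (rule antisym)
      show "ereal (?R' v) \<le> (SUP g\<in>maximizers G ?R F0. ereal (distortion_derivative g F0 v))"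
        using ex[OF v] unfolding deriv_eq by (auto intro: SUP_upper2)
      show "(SUP g\<in>maximizers G ?R F0. ereal (distortion_derivative g F0 v)) \<le> ereal (?R' v)"
        unfolding deriv_eq maxi
        by (rule SUP_least) (simp add: sup_derivative_le_slope_sup[OF p0 meas[OF v] bound[OF v]])
    qed
    ultimately show ?thesis by blast
  qed
  ultimately show ?thesis by blast
qed

end
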